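(* Let $\mathcal{I}$ be either $\mathcal{P}_\infty$ or $\mathcal{B}$. The isometry class $\{\mu\in\mathcal{I}: X_\mu$ is weakly octahedral$\}$ is $F_{\sigma\delta}$ in $\mathcal{I}$.
   Context: Coding: $V$ is the set of finitely supported rational sequences; $\mathcal{P}\subset\mathbb{R}^V$ the seminorms on $V$ with pointwise convergence topology; for $\mu\in\mathcal{P}$, $\bar\mu$ is its seminorm extension to $c_{00}$ and $X_\mu$ the completion of $c_{00}/\{\bar\mu=0\}$; $\mathcal{P}_\infty=\{\mu:\dim X_\mu=\infty\}$, $\mathcal{B}=\{\mu\in\mathcal{P}_\infty:\bar\mu$ a norm on $c_{00}\}$, subspace topologies. A Banach space $X$ is weakly octahedral (WOH) if for every finite-dimensional subspace $E\subset X$, every $f\in B_{X^*}$ and $\varepsilon>0$ there is $y\in S_X$ with $\|x+y\|\ge(1-\varepsilon)(|f(x)|+\|y\|)$ for all $x\in E$. *)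

theory Defs
  imports "HOL-Analysis.Analysis" "HOL-Library.Poly_Mapping"
begin

type_synonym V = "nat \<Rightarrow>\<^sub>0 rat"

definition vscaleQ :: "rat \<Rightarrow> V \<Rightarrow> V" where
  "vscaleQ q v = Poly_Mapping.map (\<lambda>c. q * c) v"

text \<open>P: seminorms on V (over the rationals), as a subset of R^V
  carrying the product (pointwise convergence) topology.\<close>
definition Pset :: "(V \<Rightarrow> real) set" where
  "Pset = {\<mu>. (\<forall>u v. \<mu> (u + v) \<le> \<mu> u + \<mu> v) \<and>
               (\<forall>q v. \<mu> (vscaleQ q v) = \<bar>of_rat q\<bar> * \<mu> v)}"

definition c00 :: "(nat \<Rightarrow> real) set" where
  "c00 = {x. finite {i. x i \<noteq> 0}}"

definition embV :: "V \<Rightarrow> (nat \<Rightarrow> real)" where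
  "embV v = (\<lambda>i. of_rat (Poly_Mapping.lookup v i))"

definition seminorm_c00 :: "((nat \<Rightarrow> real) \<Rightarrow> real) \<Rightarrow> bool" where
  "seminorm_c00 \<nu> \<longleftrightarrow>
     (\<forall>x\<in>c00. \<forall>y\<in>c00. \<nu> (\<lambda>i. x i + y i) \<le> \<nu> x + \<nu> y) \<and>
     (\<forall>c. \<forall>x\<in>c00. \<nu> (\<lambda>i. c * x i) = \<bar>c\<bar> * \<nu> x)"

definition mu_bar :: "(V \<Rightarrow> real) \<Rightarrow> (nat \<Rightarrow> real) \<Rightarrow> real" where
  "mu_bar \<mu> = (THE \<nu>. seminorm_c00 \<nu> \<and> (\<forall>x. x \<notin> c00 \<longrightarrow> \<nu> x = 0) \<and>
                       (\<forall>v. \<nu> (embV v) = \<mu> v))"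

text \<open>X_mu is realised as the space of mu_bar-Cauchy sequences in c00, with the
  induced (limit) seminorm; identifying sequences at distance 0 gives the completion
  of c00 / ker mu_bar. All notions below are invariant under this identification.\<close>
definition Xmu :: "(V \<Rightarrow> real) \<Rightarrow> (nat \<Rightarrow> nat \<Rightarrow> real) set" where
  "Xmu \<mu> = {s. (\<forall>n. s n \<in> c00) \<and>
     (\<forall>e>0. \<exists>N. \<forall>m\<ge>N. \<forall>n\<ge>N. mu_bar \<mu> (\<lambda>i. s m i - s n i) < e)}"

definition xnorm :: "(V \<Rightarrow> real) \<Rightarrow> (nat \<Rightarrow> nat \<Rightarrow> real) \<Rightarrow> real" where
  "xnorm \<mu> s = lim (\<lambda>n. mu_bar \<mu> (s n))"

definition xadd :: "(nat \<Rightarrow> nat \<Rightarrow> real) \<Rightarrow> (nat \<Rightarrow> nat \<Rightarrow> real) \<Rightarrow> (nat \<Rightarrow> nat \<Rightarrow> real)" where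
  "xadd s t = (\<lambda>n i. s n i + t n i)"

definition xscale :: "real \<Rightarrow> (nat \<Rightarrow> nat \<Rightarrow> real) \<Rightarrow> (nat \<Rightarrow> nat \<Rightarrow> real)" where
  "xscale c s = (\<lambda>n i. c * s n i)"

definition xlincomb :: "nat \<Rightarrow> (nat \<Rightarrow> real) \<Rightarrow> (nat \<Rightarrow> nat \<Rightarrow> nat \<Rightarrow> real) \<Rightarrow> (nat \<Rightarrow> nat \<Rightarrow> real)" where
  "xlincomb m a s = (\<lambda>n i. \<Sum>k<m. a k * s k n i)"

definition inf_dim :: "(V \<Rightarrow> real) \<Rightarrow> bool" where
  "inf_dim \<mu> \<longleftrightarrow> (\<forall>m s. (\<forall>k<m. s k \<in> Xmu \<mu>) \<longrightarrow>
      (\<exists>t\<in>Xmu \<mu>. \<forall>a. xnorm \<mu> (xadd t (xscale (-1) (xlincomb m a s))) \<noteq> 0))"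

definition dual_ball :: "(V \<Rightarrow> real) \<Rightarrow> ((nat \<Rightarrow> nat \<Rightarrow> real) \<Rightarrow> real) set" where
  "dual_ball \<mu> = {f. (\<forall>s\<in>Xmu \<mu>. \<forall>t\<in>Xmu \<mu>. \<forall>a b.
                        f (xadd (xscale a s) (xscale b t)) = a * f s + b * f t) \<and>
                     (\<forall>s\<in>Xmu \<mu>. \<bar>f s\<bar> \<le> xnorm \<mu> s)}"

text \<open>Weak octahedrality of X_mu; E ranges over finite-dimensional subspaces,
  i.e. spans of finitely many vectors s 0, ..., s (m-1).\<close>
definition WOH :: "(V \<Rightarrow> real) \<Rightarrow> bool" where
  "WOH \<mu> \<longleftrightarrow> (\<forall>m s. (\<forall>k<m. s k \<in> Xmu \<mu>) \<longrightarrow> (\<forall>f\<in>dual_ball \<mu>. \<forall>\<epsilon>>0.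
      (\<exists>y\<in>Xmu \<mu>. xnorm \<mu> y = 1 \<and>
         (\<forall>a. let x = xlincomb m a s in
              xnorm \<mu> (xadd x y) \<ge> (1 - \<epsilon>) * (\<bar>f x\<bar> + xnorm \<mu> y)))))"

definition Pinf :: "(V \<Rightarrow> real) set" where
  "Pinf = {\<mu>\<in>Pset. inf_dim \<mu>}"

definition Bset :: "(V \<Rightarrow> real) set" where
  "Bset = {\<mu>\<in>Pinf. \<forall>x\<in>c00. mu_bar \<mu> x = 0 \<longrightarrow> x = (\<lambda>i. 0)}"

definition fsigmadelta_in :: "'a topology \<Rightarrow> 'a set \<Rightarrow> bool" where
  "fsigmadelta_in X \<equiv> (countable intersection_of fsigma_in X) relative_to topspace X"

end

theory Submission
  imports Defs
begin

text \<open>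
  Quantification over functionals is removed by Hahn--Banach duality. Prescribed values \<open>q\<close> at
  finitely many \<open>v \<in> V\<close> are attained up to \<open>\<delta>\<close> by a functional dominated by \<open>\<mu>\<close> unless some rational
  combination satisfies \<open>\<Sum>l q > \<mu> (\<Sum>l v) + \<delta> \<Sum>\<bar>l\<bar>\<close>. Since balls of finite-dimensional subspaces are
  totally bounded, weak octahedrality only has to be tested on finite sets \<open>G\<close> of pairs \<open>(v, q)\<close> and
  \<open>\<delta> = 1 / (n + 1)\<close>: either the data \<open>G\<close> are infeasible, as witnessed by some \<open>l\<close>, or some \<open>w \<in> V\<close>
  almost of norm one satisfies \<open>\<mu> (v + w) \<ge> \<bar>q\<bar> + 1 - 3 \<delta>\<close> on \<open>G\<close>. For fixed \<open>l\<close> or \<open>w\<close> both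
  alternatives are closed conditions on \<open>\<mu>\<close>, and all parameters range over countable sets.
\<close>

section \<open>Additive functionals below subadditive functions\<close>

definition subadd :: "('a::ab_group_add \<Rightarrow> real) \<Rightarrow> bool" where
  "subadd p \<longleftrightarrow> (\<forall>u v. p (u + v) \<le> p u + p v)"

text \<open>Subadditivity at \<open>0\<close> forces \<open>p 0 \<ge> 0\<close>, and
  \<open>z + - z = 0\<close>. This supplies the lower bounds for the infima formed below.\<close>

lemma subadd_ge: "- p (- z) \<le> p z" if "subadd p"
proof -
  have "p (0 + 0) \<le> p 0 + p 0" "p (z + - z) \<le> p z + p (- z)"
    using that unfolding subadd_def by blast+
  then show ?thesis by simp
qed

text \<open>For fixed \<open>j\<close> take the infimum over \<open>i\<close>, then the infimum over
  \<open>j\<close>; the index \<open>k\<close> may depend on all other data. This serves chains,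
  integer multiples, translates and infimal convolutions alike.\<close>

lemma subadd_INF:
  assumes "I \<noteq> {}" and bdd: "\<And>z. \<exists>b. \<forall>i\<in>I. b \<le> g i z"
    and dir: "\<And>i j z w. i \<in> I \<Longrightarrow> j \<in> I \<Longrightarrow> \<exists>k\<in>I. g k (z + w) \<le> g i z + g j w"
  shows "subadd (\<lambda>z. INF i\<in>I. g i z :: real)"
  unfolding subadd_def
proof (intro allI)
  fix z w
  have bdd': "bdd_below ((\<lambda>i. g i x) ` I)" for x
    using bdd[of x] by (auto simp: bdd_below_def)
  have *: "(INF k\<in>I. g k (z + w)) \<le> g i z + g j w" if ij: "i \<in> I" "j \<in> I" for i j
  proof -
    obtain k where "k \<in> I" "g k (z + w) \<le> g i z + g j w" using dir[OF ij] by blast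
    then show ?thesis using cINF_lower[OF bdd', of k "z + w"] by simp
  qed
  have "(INF k\<in>I. g k (z + w)) - g j w \<le> (INF i\<in>I. g i z)" if "j \<in> I" for j
    using * that by (intro cINF_greatest[OF assms(1)]) (simp add: diff_le_eq)
  then have "(INF k\<in>I. g k (z + w)) - (INF i\<in>I. g i z) \<le> (INF j\<in>I. g j w)"
    by (intro cINF_greatest[OF assms(1)]) (simp add: algebra_simps)
  then show "(INF k\<in>I. g k (z + w)) \<le> (INF i\<in>I. g i z) + (INF j\<in>I. g j w)" by simp
qed

lemma INF_le: "(INF i\<in>I. g i :: real) \<le> g i" if "\<exists>b. \<forall>i\<in>I. b \<le> g i" "i \<in> I"
  using that by (intro cINF_lower) (auto simp: bdd_below_def)

text \<open>Zorn's lemma for the reversed pointwise order. A nonempty chain is bounded by its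
  pointwise infimum, which is finite because each member satisfies
  \<open>q z \<ge> - q (- z) \<ge> - p (- z)\<close>.\<close>

lemma minimal_subadd_below:
  assumes p: "subadd p"
  obtains m where "subadd m" "m \<le> p" "\<And>q. subadd q \<Longrightarrow> q \<le> m \<Longrightarrow> q = m"
proof -
  define A where "A = {q. subadd q \<and> q \<le> p}"
  have "\<exists>m\<in>A. \<forall>a\<in>A. m \<ge> a \<longrightarrow> a = m"
  proof (rule predicate_Zorn)
    show "partial_order_on A (relation_of (\<ge>) A)"
      by (rule partial_order_on_relation_ofI) auto
    fix C assume "C \<in> Chains (relation_of (\<ge>) A)"
    then have C: "C \<subseteq> A" and chain: "\<And>a b. a \<in> C \<Longrightarrow> b \<in> C \<Longrightarrow> a \<le> b \<or> b \<le> a"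
      by (auto simp: Chains_def relation_of_def)
    show "\<exists>u\<in>A. \<forall>a\<in>C. u \<le> a"
    proof (cases "C = {}")
      case True
      then show ?thesis using p by (auto simp: A_def)
    next
      case False
      have bdd: "\<exists>b. \<forall>q\<in>C. b \<le> q z" for z
      proof (intro exI[of _ "- p (- z)"] ballI)
        fix q assume "q \<in> C"
        then have "subadd q" "q (- z) \<le> p (- z)" using C by (auto simp: A_def le_fun_def)
        then show "- p (- z) \<le> q z" using subadd_ge[of q z] by simp
      qed
      define u where "u = (\<lambda>z. INF q\<in>C. q z)"
      have "subadd u" unfolding u_def
      proof (rule subadd_INF[OF False bdd])
        fix q r z w assume qr: "q \<in> C" "r \<in> C"
        then have sub: "q (z + w) \<le> q z + q w" "r (z + w) \<le> r z + r w"
          using C by (auto simp: A_def subadd_def)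
        \<comment> \<open>Of two members of a chain the smaller one serves as
          \<open>k\<close>.\<close>
        show "\<exists>k\<in>C. k (z + w) \<le> q z + r w"
        proof (cases "q \<le> r")
          case True
          then have "q w \<le> r w" by (simp add: le_fun_def)
          then show ?thesis using sub qr by (intro bexI[of _ q]) auto
        next
          case False
          then have "r z \<le> q z" using chain[OF qr] by (auto simp: le_fun_def)
          then show ?thesis using sub qr by (intro bexI[of _ r]) auto
        qed
      qed
      moreover have le: "u \<le> q" if "q \<in> C" for q
        unfolding u_def le_fun_def by (intro allI INF_le[OF bdd that])
      moreover obtain q where "q \<in> C" using False by blast
      then have "u \<le> p" using le[of q] C by (auto simp: A_def intro: order_trans)
      ultimately show ?thesis by (auto simp: A_def)
    qed
  qed
  then obtain m where "m \<in> A" "\<And>a. a \<in> A \<Longrightarrow> a \<le> m \<Longrightarrow> a = m" by blast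
  then show thesis by (intro that[of m]) (auto simp: A_def intro: order_trans)
qed

definition ntimes :: "nat \<Rightarrow> 'a::ab_group_add \<Rightarrow> 'a" where
  "ntimes n z = (\<Sum>i<n. z)"

lemma ntimes_simps [simp]: "ntimes 0 z = 0" "ntimes (Suc n) z = ntimes n z + z"
  by (simp_all add: ntimes_def)

lemma ntimes_add: "ntimes n (z + w) = ntimes n z + ntimes n w"
  by (simp add: ntimes_def sum.distrib)

lemma ntimes_uminus: "ntimes n (- z) = - ntimes n z"
  by (simp add: ntimes_def sum_negf)

lemma ntimes_plus: "ntimes (n + k) z = ntimes n z + ntimes k z"
  by (induction k) (simp_all add: add.assoc)

lemma ntimes_mult: "ntimes (k * n) z = ntimes k (ntimes n z)"
  by (induction k) (simp_all add: ntimes_plus add.commute)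

text \<open>Positivity of \<open>n\<close> matters because \<open>p 0\<close> may be positive; hence
  the induction really starts at \<open>n = 1\<close>.\<close>

lemma subadd_ntimes:
  assumes "subadd p" "n > 0"
  shows "p (ntimes n z) \<le> n * p z"
  using assms(2)
proof (induction n)
  case (Suc n)
  have "p (ntimes n z + z) \<le> p (ntimes n z) + p z" using assms(1) by (simp add: subadd_def)
  then show ?case using Suc by (cases "n = 0") (auto simp: algebra_simps)
qed simp

text \<open>Minimality is tested against \<open>z \<mapsto> inf\<^sub>n p (n z) / n\<close>, which gives homogeneity, and then
  against \<open>z \<mapsto> inf\<^sub>n (p (z + n x) - n p x)\<close>, which gives superadditivity.\<close>

theorem additive_below_subadd:
  fixes p :: "'a::ab_group_add \<Rightarrow> real"
  assumes "subadd p"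
  obtains f where "Modules.additive f" "\<And>z. f z \<le> p z"
proof -
  obtain m where m: "subadd m" "m \<le> p" and min: "\<And>q. subadd q \<Longrightarrow> q \<le> m \<Longrightarrow> q = m"
    using minimal_subadd_below[OF assms] by blast
  have sub: "m (u + v) \<le> m u + m v" for u v using m(1) by (simp add: subadd_def)
  have homog: "n * m z \<le> m (ntimes n z)" if "n > 0" for n z
  proof -
    define g where "g n z = m (ntimes n z) / n" for n z
    have bdd: "\<exists>b. \<forall>n\<in>{0<..}. b \<le> g n z" for z
    proof (intro exI[of _ "- m (- z)"] ballI)
      fix n :: nat assume "n \<in> {0<..}"
      then show "- m (- z) \<le> g n z"
        using subadd_ge[OF m(1), of "ntimes n z"] subadd_ntimes[OF m(1), of n "- z"]
        by (simp add: g_def field_simps ntimes_uminus)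
    qed
    have "subadd (\<lambda>z. INF n\<in>{0<..}. g n z)"
    proof (rule subadd_INF[OF _ bdd])
      fix n k z w assume nk: "n \<in> {0::nat<..}" "k \<in> {0::nat<..}"
      \<comment> \<open>The common multiple \<open>n * k\<close> splits both ways: as
        \<open>k\<close> copies of \<open>ntimes n z\<close> and as \<open>n\<close> copies of
        \<open>ntimes k w\<close>.\<close>
      have "m (ntimes (n * k) (z + w)) \<le> m (ntimes (k * n) z) + m (ntimes (n * k) w)"
        using sub by (simp add: ntimes_add mult.commute)
      also have "\<dots> \<le> k * m (ntimes n z) + n * m (ntimes k w)"
        unfolding ntimes_mult using nk by (intro add_mono subadd_ntimes[OF m(1)]) auto
      finally have "g (n * k) (z + w) \<le> g n z + g k w"
        using nk by (simp add: g_def field_simps)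
      then show "\<exists>l\<in>{0<..}. g l (z + w) \<le> g n z + g k w" using nk by (intro bexI[of _ "n * k"]) auto
    qed auto
    moreover have "(\<lambda>z. INF n\<in>{0<..}. g n z) \<le> m"
      unfolding le_fun_def
    proof
      fix z show "(INF n\<in>{0<..}. g n z) \<le> m z" using INF_le[OF bdd[of z], of 1] by (simp add: g_def)
    qed
    ultimately have "m z = (INF n\<in>{0<..}. g n z)" using min by metis
    also have "\<dots> \<le> g n z" using that by (intro INF_le[OF bdd]) auto
    finally show ?thesis using that by (simp add: g_def field_simps)
  qed
  have super: "m z + m x \<le> m (z + x)" for z x
  proof -
    define g where "g n z = m (z + ntimes n x) - n * m x" for n z
    have bdd: "\<exists>b. \<forall>n\<in>UNIV. b \<le> g n z" for z
    proof (intro exI[of _ "- m (- z)"] ballI)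
      fix n
      \<comment> \<open>Homogeneity keeps \<open>m (ntimes n x)\<close> from falling below
        \<open>n * m x\<close>, so subtracting \<open>n * m x\<close> cannot make the infimum
        unbounded; \<open>n = 0\<close> is \<open>subadd_ge\<close>.\<close>
      show "- m (- z) \<le> g n z"
        using sub[of "z + ntimes n x" "- z"] homog[of n x] subadd_ge[OF m(1), of z]
        by (cases "n = 0") (auto simp: g_def)
    qed
    have "subadd (\<lambda>z. INF n. g n z)"
    proof (rule subadd_INF[OF _ bdd])
      fix n k z w
      have "g (n + k) (z + w) \<le> g n z + g k w"
        using sub[of "z + ntimes n x" "w + ntimes k x"]
        by (simp add: g_def ntimes_plus algebra_simps)
      then show "\<exists>l\<in>UNIV. g l (z + w) \<le> g n z + g k w" by blast
    qed auto
    moreover have "(\<lambda>z. INF n. g n z) \<le> m"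
      unfolding le_fun_def
    proof
      fix z show "(INF n. g n z) \<le> m z" using INF_le[OF bdd[of z], of 0] by (simp add: g_def)
    qed
    \<comment> \<open>By minimality the infimum is \<open>m\<close> itself; its index
      \<open>1\<close> is superadditivity.\<close>
    ultimately have "m z = (INF n. g n z)" using min by metis
    also have "\<dots> \<le> g 1 z" by (intro INF_le[OF bdd]) auto
    finally show ?thesis by (simp add: g_def)
  qed
  have "Modules.additive m" using sub super by unfold_locales (simp add: antisym)
  then show thesis using m(2) that by (auto simp: le_fun_def)
qed

section \<open>Rational scalars on \<open>V\<close> and functionals dominated by a seminorm\<close>

lemma lookup_vscaleQ [simp]: "Poly_Mapping.lookup (vscaleQ q v) i = q * Poly_Mapping.lookup v i"
  unfolding vscaleQ_def by (simp add: Poly_Mapping.map.rep_eq when_def)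

lemma vscaleQ_add_left: "vscaleQ (a + b) v = vscaleQ a v + vscaleQ b v"
  by (rule poly_mapping_eqI) (simp add: lookup_add algebra_simps)

lemma vscaleQ_vscaleQ: "vscaleQ a (vscaleQ b v) = vscaleQ (a * b) v"
  by (rule poly_mapping_eqI) simp

lemma vscaleQ_0 [simp]: "vscaleQ 0 v = 0" and vscaleQ_1 [simp]: "vscaleQ 1 v = v"
  and vscaleQ_minus_1 [simp]: "vscaleQ (- 1) v = - v"
  by (rule poly_mapping_eqI, simp)+

lemma vscaleQ_uminus: "vscaleQ (- a) v = - vscaleQ a v"
  by (rule poly_mapping_eqI) simp

text \<open>The dual unit ball of \<open>V\<close> as a rational vector space seminormed by
  \<open>\<mu>\<close>. Additivity stands for rational linearity, which it implies by
  \<open>additive_vscaleQ\<close>.\<close>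

definition ratdual :: "(V \<Rightarrow> real) \<Rightarrow> (V \<Rightarrow> real) set" where
  "ratdual \<mu> = {h. Modules.additive h \<and> (\<forall>v. \<bar>h v\<bar> \<le> \<mu> v)}"

lemma PsetD:
  assumes "\<mu> \<in> Pset"
  shows "\<mu> (u + v) \<le> \<mu> u + \<mu> v" "\<mu> (vscaleQ q v) = \<bar>of_rat q\<bar> * \<mu> v" "\<mu> 0 = 0"
    "\<mu> (- v) = \<mu> v" "\<mu> v \<ge> 0" "\<mu> (u - v) \<le> \<mu> u + \<mu> v"
proof -
  have *: "\<mu> (u + v) \<le> \<mu> u + \<mu> v" "\<mu> (vscaleQ q v) = \<bar>of_rat q\<bar> * \<mu> v" for u v q
    using assms by (auto simp: Pset_def)
  show **: "\<mu> 0 = 0" "\<mu> (- v) = \<mu> v" for v using *(2)[of 0 0] *(2)[of "-1" v] by simp_all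
  show "\<mu> v \<ge> 0" using *(1)[of v "- v"] ** by simp
  show "\<mu> (u - v) \<le> \<mu> u + \<mu> v" using *(1)[of u "- v"] ** by simp
qed (use assms in \<open>auto simp: Pset_def\<close>)

text \<open>The additive functional is found below the infimal convolution of \<open>\<mu>\<close> with the
  \<open>\<epsilon>\<close>-relaxed prescription.\<close>

lemma ratdual_interpolation:
  fixes x :: "'i \<Rightarrow> V" and c :: "'i \<Rightarrow> real"
  assumes \<mu>: "\<mu> \<in> Pset" and G: "finite G" and \<epsilon>: "\<epsilon> \<ge> 0"
    and M: "\<And>l. (\<Sum>g\<in>G. of_rat (l g) * c g)
      \<le> \<mu> (\<Sum>g\<in>G. vscaleQ (l g) (x g)) + \<epsilon> * (\<Sum>g\<in>G. \<bar>of_rat (l g)\<bar>)"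
  obtains h where "h \<in> ratdual \<mu>" "\<And>g. g \<in> G \<Longrightarrow> \<bar>h (x g) - c g\<bar> \<le> \<epsilon>"
proof -
  note \<mu>' = PsetD[OF \<mu>]
  define W where "W l = (\<Sum>g\<in>G. vscaleQ (l g) (x g))" for l
  define C where "C l = (\<Sum>g\<in>G. of_rat (l g) * c g)" for l
  define L where "L l = (\<Sum>g\<in>G. \<bar>of_rat (l g) :: real\<bar>)" for l
  have neg: "C (\<lambda>g. - l g) = - C l" "W (\<lambda>g. - l g) = - W l" "L (\<lambda>g. - l g) = L l" for l
    by (simp_all add: C_def W_def L_def vscaleQ_uminus sum_negf of_rat_minus)
  \<comment> \<open>Applying the hypothesis to \<open>- l\<close> gives the lower bound on
    \<open>C l\<close> that keeps the following infimum finite.\<close>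
  have M': "- C l \<le> \<mu> (W l) + \<epsilon> * L l" for l
    using M[of "\<lambda>g. - l g"] unfolding C_def[symmetric] W_def[symmetric] L_def[symmetric] neg
    by (simp add: \<mu>')
  \<comment> \<open>Each \<open>l\<close> contributes one upper bound for the functional:
    \<open>l = 0\<close> yields domination by \<open>\<mu>\<close>, and plus or minus a unit vector
    yields the two halves of \<open>\<bar>h (x g) - c g\<bar> \<le> \<epsilon>\<close>.\<close>
  define p where "p l z = \<mu> (z - W l) + C l + \<epsilon> * L l" for l z
  have bdd: "\<exists>b. \<forall>l\<in>UNIV. b \<le> p l z" for z
  proof (intro exI[of _ "- \<mu> z"] ballI)
    fix l
    have "\<mu> (W l) \<le> \<mu> z + \<mu> (z - W l)" using \<mu>'(6)[of z "z - W l"] by simp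
    then show "- \<mu> z \<le> p l z" using M'[of l] by (simp add: p_def)
  qed
  have "subadd (\<lambda>z. INF l. p l z)"
  proof (rule subadd_INF[OF _ bdd])
    fix l k :: "'i \<Rightarrow> rat" and z w
    define s where "s = (\<lambda>g. l g + k g)"
    have "W s = W l + W k" "C s = C l + C k"
      by (simp_all add: s_def W_def C_def vscaleQ_add_left of_rat_add algebra_simps sum.distrib)
    moreover have "L s \<le> L l + L k"
      unfolding L_def sum.distrib[symmetric] by (intro sum_mono) (simp add: s_def of_rat_add abs_triangle_ineq del: abs_of_rat)
    then have "\<epsilon> * L s \<le> \<epsilon> * L l + \<epsilon> * L k"
      using \<epsilon> by (simp add: distrib_left[symmetric] mult_left_mono)
    ultimately have "p s (z + w) \<le> p l z + p k w"
      using \<mu>'(1)[of "z - W l" "w - W k"] by (simp add: p_def algebra_simps)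
    then show "\<exists>j\<in>UNIV. p j (z + w) \<le> p l z + p k w" by blast
  qed simp
  then obtain h where h: "Modules.additive h" "\<And>z. h z \<le> (INF l. p l z)"
    using additive_below_subadd by blast
  interpret Modules.additive h by fact
  have le: "h z \<le> p l z" for z l
    using h(2)[of z] INF_le[OF bdd[of z], of l] by simp
  have zero: "W (\<lambda>_. 0) = 0" "C (\<lambda>_. 0) = 0" "L (\<lambda>_. 0) = 0" by (simp_all add: W_def C_def L_def)
  have "h z \<le> \<mu> z" for z using le[of z "\<lambda>_. 0"] by (simp add: p_def zero)
  from this this[of "- z" for z] have "h \<in> ratdual \<mu>"
    using h(1) by (auto simp: ratdual_def abs_le_iff minus \<mu>')
  moreover have "\<bar>h (x g) - c g\<bar> \<le> \<epsilon>" if g: "g \<in> G" for g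
  proof -
    define l where "l = (\<lambda>j. if j = g then 1::rat else 0)"
    have "W l = x g" "C l = c g" "L l = 1"
      using G g by (simp_all add: l_def W_def C_def L_def if_distrib[of "\<lambda>x. vscaleQ x _"]
          if_distrib[of of_rat] if_distrib[of abs] if_distrib[of "\<lambda>x. x * _"] cong: if_cong)
    then show ?thesis
      using le[of "x g" l] le[of "- x g" "\<lambda>g. - l g"] by (simp add: p_def neg minus \<mu>')
  qed
  ultimately show thesis by (rule that)
qed

section \<open>The seminorm extension to finitely supported sequences\<close>

text \<open>Additivity passes to naturals by induction, to integers by negation, and to rationals by
  clearing the denominator.\<close>

lemma additive_vscaleQ:
  assumes "Modules.additive h"
  shows "h (vscaleQ q v) = of_rat q * (h v :: real)"
proof -
  interpret Modules.additive h by fact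
  have nat: "h (vscaleQ (of_nat n) v) = of_nat n * h v" for n v
    by (induction n) (simp_all add: vscaleQ_add_left add zero algebra_simps)
  have int: "h (vscaleQ (of_int k) v) = of_int k * h v" for k v
    by (cases k rule: int_cases2) (simp_all add: nat vscaleQ_uminus minus)
  obtain a b where q: "q = of_int a / of_int b" "b > 0"
    by (metis quotient_of_div quotient_of_denom_pos prod.collapse)
  have "of_int b * h (vscaleQ q v) = h (vscaleQ (of_int b) (vscaleQ q v))" by (simp add: int)
  also have "\<dots> = h (vscaleQ (of_int a) v)" using q by (simp add: vscaleQ_vscaleQ)
  finally have "of_int b * h (vscaleQ q v) = of_int a * h v" by (simp add: int)
  then have "h (vscaleQ q v) = (of_int a / of_int b) * h v" using q(2) by (simp add: field_simps)
  then show ?thesis using q by (simp add: of_rat_divide)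
qed

lemma c00_0 [simp]: "(\<lambda>i. 0) \<in> c00"
  by (simp add: c00_def)

lemma c00_add [simp]: "x \<in> c00 \<Longrightarrow> y \<in> c00 \<Longrightarrow> (\<lambda>i. x i + y i) \<in> c00"
  unfolding c00_def by (auto intro: finite_subset[of _ "{i. x i \<noteq> 0} \<union> {i. y i \<noteq> 0}"])

lemma c00_scale [simp]: "x \<in> c00 \<Longrightarrow> (\<lambda>i. c * x i) \<in> c00"
  unfolding c00_def by (auto intro: finite_subset[of _ "{i. x i \<noteq> 0}"])

lemma c00_diff [simp]: "x \<in> c00 \<Longrightarrow> y \<in> c00 \<Longrightarrow> (\<lambda>i. x i - y i) \<in> c00"
  unfolding c00_def by (auto intro: finite_subset[of _ "{i. x i \<noteq> 0} \<union> {i. y i \<noteq> 0}"])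

lemma c00_embV [simp]: "embV v \<in> c00"
  unfolding c00_def embV_def by simp

lemma c00_sum [simp]: "finite K \<Longrightarrow> (\<And>k. k \<in> K \<Longrightarrow> x k \<in> c00) \<Longrightarrow> (\<lambda>i. \<Sum>k\<in>K. x k i) \<in> c00"
  by (induction K rule: finite_induct) auto

lemma embV_add: "embV (v + w) = (\<lambda>i. embV v i + embV w i)"
  by (simp add: embV_def lookup_add of_rat_add fun_eq_iff)

definition unitV :: "nat \<Rightarrow> V" where
  "unitV i = Poly_Mapping.single i 1"

lemma sum_unitV: "(\<Sum>i\<in>Poly_Mapping.keys v. vscaleQ (Poly_Mapping.lookup v i) (unitV i)) = v"
proof (rule poly_mapping_eqI)
  fix j
  show "Poly_Mapping.lookup (\<Sum>i\<in>Poly_Mapping.keys v. vscaleQ (Poly_Mapping.lookup v i) (unitV i)) j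
    = Poly_Mapping.lookup v j"
    by (simp add: lookup_sum unitV_def lookup_single when_def if_distrib[of "\<lambda>x. _ * x"] in_keys_iff
        cong: if_cong)
qed

text \<open>The linear map on \<open>c00\<close> with the values of \<open>h\<close> at the unit
  vectors; along \<open>embV\<close> it restricts to \<open>h\<close> when \<open>h\<close> is
  additive.\<close>

definition ext :: "(V \<Rightarrow> real) \<Rightarrow> (nat \<Rightarrow> real) \<Rightarrow> real" where
  "ext h x = (\<Sum>i | x i \<noteq> 0. x i * h (unitV i))"

lemma ext_eq: "ext h x = (\<Sum>i\<in>S. x i * h (unitV i))" if "finite S" "{i. x i \<noteq> 0} \<subseteq> S"
  unfolding ext_def using that by (intro sum.mono_neutral_left) auto

lemma ext_add:
  assumes "x \<in> c00" "y \<in> c00"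
  shows "ext h (\<lambda>i. x i + y i) = ext h x + ext h y"
proof -
  define S where "S = {i. x i \<noteq> 0} \<union> {i. y i \<noteq> 0}"
  have "finite S" using assms by (simp add: S_def c00_def)
  then show ?thesis
    by (subst (1 2 3) ext_eq[of S]) (auto simp: S_def algebra_simps sum.distrib)
qed

lemma ext_scale:
  assumes "x \<in> c00"
  shows "ext h (\<lambda>i. c * x i) = c * ext h x"
proof -
  have "finite {i. x i \<noteq> 0}" using assms by (simp add: c00_def)
  then show ?thesis
    by (subst (1 2) ext_eq[of "{i. x i \<noteq> 0}"]) (auto simp: sum_distrib_left mult.assoc)
qed

lemma ext_embV: "Modules.additive h \<Longrightarrow> ext h (embV v) = h v"
proof -
  assume h: "Modules.additive h"
  have "ext h (embV v) = (\<Sum>i\<in>Poly_Mapping.keys v. embV v i * h (unitV i))"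
    by (rule ext_eq) (auto simp: embV_def in_keys_iff)
  also have "\<dots> = h (\<Sum>i\<in>Poly_Mapping.keys v. vscaleQ (Poly_Mapping.lookup v i) (unitV i))"
    by (simp add: additive.sum[OF h] additive_vscaleQ[OF h] embV_def)
  finally show ?thesis by (simp add: sum_unitV)
qed

lemma seminorm_c00D:
  assumes "seminorm_c00 \<nu>" "x \<in> c00" "y \<in> c00"
  shows "\<nu> (\<lambda>i. x i + y i) \<le> \<nu> x + \<nu> y" "\<nu> (\<lambda>i. c * x i) = \<bar>c\<bar> * \<nu> x" "\<nu> (\<lambda>i. 0) = 0"
    "\<nu> x \<ge> 0" "\<nu> (\<lambda>i. x i - y i) \<le> \<nu> x + \<nu> y" "\<nu> (\<lambda>i. x i - y i) = \<nu> (\<lambda>i. y i - x i)"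
    "\<bar>\<nu> x - \<nu> y\<bar> \<le> \<nu> (\<lambda>i. x i - y i)"
proof -
  have *: "\<nu> (\<lambda>i. x i + y i) \<le> \<nu> x + \<nu> y" "\<nu> (\<lambda>i. c * x i) = \<bar>c\<bar> * \<nu> x"
    if "x \<in> c00" "y \<in> c00" for x y c
    using assms(1) that by (auto simp: seminorm_c00_def)
  show **: "\<nu> (\<lambda>i. 0) = 0" using *(2)[of x x 0] assms by simp
  have neg: "\<nu> (\<lambda>i. - y i) = \<nu> y" "(\<lambda>i. - y i) \<in> c00" if "y \<in> c00" for y
    using *(2)[of y y "-1"] c00_scale[of y "-1"] that by simp_all
  show "\<nu> x \<ge> 0" using *(1)[of x "\<lambda>i. - x i"] neg[of x] ** assms by simp
  show "\<nu> (\<lambda>i. x i - y i) \<le> \<nu> x + \<nu> y" using *(1)[of x "\<lambda>i. - y i"] neg[of y] assms by simp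
  show sym: "\<nu> (\<lambda>i. x i - y i) = \<nu> (\<lambda>i. y i - x i)"
    using neg(1)[of "\<lambda>i. x i - y i"] assms by simp
  have "\<nu> x \<le> \<nu> (\<lambda>i. x i - y i) + \<nu> y" "\<nu> y \<le> \<nu> (\<lambda>i. y i - x i) + \<nu> x"
    using *(1)[of "\<lambda>i. x i - y i" y] *(1)[of "\<lambda>i. y i - x i" x] assms by simp_all
  then show "\<bar>\<nu> x - \<nu> y\<bar> \<le> \<nu> (\<lambda>i. x i - y i)" using sym by simp
qed (use assms in \<open>auto simp: seminorm_c00_def\<close>)

lemma seminorm_c00_sum:
  assumes \<nu>: "seminorm_c00 \<nu>" and "finite K" "\<And>k. k \<in> K \<Longrightarrow> x k \<in> c00"
  shows "\<nu> (\<lambda>i. \<Sum>k\<in>K. x k i) \<le> (\<Sum>k\<in>K. \<nu> (x k))"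
  using assms(2,3)
proof (induction K rule: finite_induct)
  case empty
  then show ?case using seminorm_c00D(3)[OF \<nu> c00_0 c00_0] by simp
next
  case (insert k K)
  then show ?case
    using seminorm_c00D(1)[OF \<nu>, of "x k" "\<lambda>i. \<Sum>k\<in>K. x k i"] by fastforce
qed

lemma embV_unitV: "embV (unitV k) = (\<lambda>i. if i = k then 1 else 0)"
  by (auto simp: embV_def unitV_def lookup_single when_def fun_eq_iff)

text \<open>Round the finitely many nonzero coordinates to rationals within \<open>d\<close>. The
  error is at most \<open>d * M\<close>, with \<open>M\<close> the sum of the seminorms of the unit
  vectors in the support; dividing by \<open>M + 1\<close> keeps it strictly below \<open>e\<close>,
  also for \<open>M = 0\<close>.\<close>

lemma embV_dense:
  assumes \<nu>: "seminorm_c00 \<nu>" and x: "x \<in> c00" and "e > 0"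
  obtains v where "\<nu> (\<lambda>i. x i - embV v i) < e"
proof -
  define S where "S = {i. x i \<noteq> 0}"
  have S: "finite S" using x by (simp add: S_def c00_def)
  define M where "M = (\<Sum>i\<in>S. \<nu> (embV (unitV i)))"
  have nonneg: "\<nu> (embV w) \<ge> 0" for w using seminorm_c00D(4)[OF \<nu> c00_embV c00_embV] .
  have M: "M \<ge> 0" unfolding M_def by (intro sum_nonneg) (simp add: nonneg)
  define d where "d = e / (M + 1)"
  have d: "d > 0" using M assms(3) by (simp add: d_def)
  have "\<exists>r. \<bar>x i - of_rat r\<bar> < d" for i
  proof -
    obtain r where "x i - d < of_rat r" "of_rat r < x i + d"
      using of_rat_dense[of "x i - d" "x i + d"] d by auto
    then show ?thesis by (intro exI[of _ r]) auto
  qed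
  then obtain r where r: "\<And>i. \<bar>x i - of_rat (r i)\<bar> < d" by metis
  define v where "v = (\<Sum>k\<in>S. vscaleQ (r k) (unitV k))"
  have v: "x i - embV v i = (\<Sum>k\<in>S. (x k - of_rat (r k)) * embV (unitV k) i)" for i
  proof -
    have "Poly_Mapping.lookup v i = (if i \<in> S then r i else 0)"
      using S by (simp add: v_def lookup_sum unitV_def lookup_single when_def
          if_distrib[of "\<lambda>x. _ * x"] cong: if_cong)
    moreover have "(\<Sum>k\<in>S. (x k - of_rat (r k)) * embV (unitV k) i) = (if i \<in> S then x i - of_rat (r i) else 0)"
      using S by (simp add: embV_unitV if_distrib[of "\<lambda>x. _ * x"] cong: if_cong)
    ultimately show ?thesis by (auto simp: embV_def S_def)
  qed
  have "\<nu> (\<lambda>i. x i - embV v i) \<le> (\<Sum>k\<in>S. \<nu> (\<lambda>i. (x k - of_rat (r k)) * embV (unitV k) i))"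
    unfolding v by (rule seminorm_c00_sum[OF \<nu> S]) simp
  also have "\<dots> = (\<Sum>k\<in>S. \<bar>x k - of_rat (r k)\<bar> * \<nu> (embV (unitV k)))"
    by (intro sum.cong refl seminorm_c00D(2)[OF \<nu> c00_embV c00_embV])
  also have "\<dots> \<le> (\<Sum>k\<in>S. d * \<nu> (embV (unitV k)))"
    using r by (intro sum_mono mult_right_mono nonneg) (simp add: less_imp_le)
  also have "\<dots> = d * M" by (simp add: M_def sum_distrib_left)
  also have "\<dots> < e" using M assms(3) by (simp add: d_def field_simps)
  finally show thesis by (rule that)
qed

text \<open>Density for the seminorm \<open>\<nu> + \<rho>\<close> yields a single rational vector
  that is close to \<open>x\<close> for both seminorms at once.\<close>

lemma seminorm_c00_unique:
  assumes a: "seminorm_c00 \<nu>" and b: "seminorm_c00 \<rho>" and eq: "\<And>v. \<nu> (embV v) = \<rho> (embV v)"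
    and x: "x \<in> c00"
  shows "\<nu> x = \<rho> x"
proof -
  have sum: "seminorm_c00 (\<lambda>x. \<nu> x + \<rho> x)"
    using a b unfolding seminorm_c00_def by (auto simp: algebra_simps intro: add_mono)
      (smt (verit, best))
  have "\<bar>\<nu> x - \<rho> x\<bar> \<le> e" if e: "e > 0" for e
  proof -
    obtain v where v: "\<nu> (\<lambda>i. x i - embV v i) + \<rho> (\<lambda>i. x i - embV v i) < e"
      using embV_dense[OF sum x e] by blast
    then show ?thesis
      using seminorm_c00D(7)[OF a x c00_embV[of v]] seminorm_c00D(7)[OF b x c00_embV[of v]] eq[of v]
      by linarith
  qed
  then have "\<bar>\<nu> x - \<rho> x\<bar> \<le> 0" by (rule field_le_epsilon) simp
  then show ?thesis by simp
qed

text \<open>The norming form of Hahn--Banach: interpolation of the single value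
  \<open>\<mu> v\<close> with tolerance \<open>0\<close>, where the compatibility condition is just
  \<open>q \<le> \<bar>q\<bar>\<close> times \<open>\<mu> v\<close>.\<close>

lemma ratdual_norming:
  assumes \<mu>: "\<mu> \<in> Pset"
  obtains h where "h \<in> ratdual \<mu>" "h v = \<mu> v"
proof -
  have *: "of_rat q * \<mu> v \<le> \<bar>of_rat q\<bar> * \<mu> v" for q
    using PsetD(5)[OF \<mu>] by (intro mult_right_mono abs_ge_self)
  obtain h where "h \<in> ratdual \<mu>" "\<And>g. g \<in> {()} \<Longrightarrow> \<bar>h v - \<mu> v\<bar> \<le> 0"
    by (rule ratdual_interpolation[OF \<mu>, of "{()}" 0 "\<lambda>_. \<mu> v" "\<lambda>_. v"])
      (use * in \<open>simp_all add: PsetD(2)[OF \<mu>]\<close>)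
  then show thesis by (intro that[of h]) auto
qed

text \<open>The definite description in \<open>mu_bar\<close> requires existence and uniqueness. The
  supremum of \<open>\<bar>ext h x\<bar>\<close> over \<open>ratdual \<mu>\<close> is a seminorm,
  and it extends \<open>\<mu>\<close> by \<open>ratdual_norming\<close>; uniqueness is density of
  \<open>V\<close>. The third claim is then part of the construction.\<close>

lemma mu_bar_seminorm_extension:
  assumes \<mu>: "\<mu> \<in> Pset"
  shows "seminorm_c00 (mu_bar \<mu>)" "mu_bar \<mu> (embV v) = \<mu> v"
    "h \<in> ratdual \<mu> \<Longrightarrow> x \<in> c00 \<Longrightarrow> \<bar>ext h x\<bar> \<le> mu_bar \<mu> x"
proof -
  define \<nu> where "\<nu> x = (if x \<in> c00 then SUP h\<in>ratdual \<mu>. \<bar>ext h x\<bar> else 0)" for x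
  have ne: "ratdual \<mu> \<noteq> {}" using ratdual_norming[OF \<mu>] by blast
  have bdd: "bdd_above ((\<lambda>h. \<bar>ext h x\<bar>) ` ratdual \<mu>)" if "x \<in> c00" for x
  proof (rule bdd_aboveI2)
    fix h assume h: "h \<in> ratdual \<mu>"
    show "\<bar>ext h x\<bar> \<le> (\<Sum>i | x i \<noteq> 0. \<bar>x i\<bar> * \<mu> (unitV i))"
      unfolding ext_def using h
      by (intro order_trans[OF sum_abs] sum_mono) (auto simp: abs_mult ratdual_def intro!: mult_left_mono)
  qed
  have le: "\<bar>ext h x\<bar> \<le> \<nu> x" if "h \<in> ratdual \<mu>" "x \<in> c00" for h x
    using cSUP_upper[OF that(1) bdd[OF that(2)]] that(2) by (simp add: \<nu>_def)
  have least: "\<nu> x \<le> b" if "x \<in> c00" "\<And>h. h \<in> ratdual \<mu> \<Longrightarrow> \<bar>ext h x\<bar> \<le> b" for x b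
    using cSUP_least[OF ne, of "\<lambda>h. \<bar>ext h x\<bar>"] that by (simp add: \<nu>_def)
  have nu_emb: "\<nu> (embV v) = \<mu> v" for v
  proof (rule antisym)
    show "\<nu> (embV v) \<le> \<mu> v" by (rule least) (auto simp: ratdual_def ext_embV)
    obtain h where "h \<in> ratdual \<mu>" "h v = \<mu> v" using ratdual_norming[OF \<mu>] .
    then show "\<mu> v \<le> \<nu> (embV v)" using le[of h "embV v"] by (auto simp: ratdual_def ext_embV)
  qed
  have scale_le: "\<nu> (\<lambda>i. c * x i) \<le> \<bar>c\<bar> * \<nu> x" if "x \<in> c00" for c x
    using that le by (intro least) (auto simp: ext_scale abs_mult intro!: mult_left_mono)
  have nu: "seminorm_c00 \<nu>" unfolding seminorm_c00_def
  proof (intro conjI ballI allI)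
    fix x y assume xy: "x \<in> c00" "y \<in> c00"
    show "\<nu> (\<lambda>i. x i + y i) \<le> \<nu> x + \<nu> y"
    proof (rule least)
      fix h assume "h \<in> ratdual \<mu>"
      then show "\<bar>ext h (\<lambda>i. x i + y i)\<bar> \<le> \<nu> x + \<nu> y"
        using le[of h x] le[of h y] xy by (simp add: ext_add)
    qed (use xy in simp)
  next
    fix c x assume x: "x \<in> c00"
    show "\<nu> (\<lambda>i. c * x i) = \<bar>c\<bar> * \<nu> x"
    proof (cases "c = 0")
      case True
      then show ?thesis using nu_emb[of 0] PsetD(3)[OF \<mu>] by (simp add: embV_def)
    next
      case False
      \<comment> \<open>The reverse inequality is \<open>scale_le\<close> for the scalar
        \<open>1 / c\<close>.\<close>
      have "\<bar>c\<bar> * \<nu> x \<le> \<nu> (\<lambda>i. c * x i)"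
        using scale_le[of "\<lambda>i. c * x i" "1 / c"] False x by (simp add: field_simps)
      then show ?thesis using scale_le[OF x, of c] by simp
    qed
  qed
  have "mu_bar \<mu> = \<nu>" unfolding mu_bar_def
  proof (rule the_equality)
    show "seminorm_c00 \<nu> \<and> (\<forall>x. x \<notin> c00 \<longrightarrow> \<nu> x = 0) \<and> (\<forall>v. \<nu> (embV v) = \<mu> v)"
      using nu nu_emb by (simp add: \<nu>_def)
    fix \<rho> assume \<rho>: "seminorm_c00 \<rho> \<and> (\<forall>x. x \<notin> c00 \<longrightarrow> \<rho> x = 0) \<and> (\<forall>v. \<rho> (embV v) = \<mu> v)"
    have "\<rho> x = \<nu> x" for x
      using seminorm_c00_unique[of \<rho> \<nu> x] \<rho> nu nu_emb by (cases "x \<in> c00") (auto simp: \<nu>_def)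
    then show "\<rho> = \<nu>" by blast
  qed
  then show "seminorm_c00 (mu_bar \<mu>)" "mu_bar \<mu> (embV v) = \<mu> v"
    "h \<in> ratdual \<mu> \<Longrightarrow> x \<in> c00 \<Longrightarrow> \<bar>ext h x\<bar> \<le> mu_bar \<mu> x"
    using nu nu_emb le by auto
qed

section \<open>The completion and its dual ball\<close>

locale coded_space =
  fixes \<mu> :: "V \<Rightarrow> real"
  assumes mu: "\<mu> \<in> Pset"
begin

lemmas mu_bar = seminorm_c00D[OF mu_bar_seminorm_extension(1)[OF mu]]
lemmas mu_bar_embV = mu_bar_seminorm_extension(2)[OF mu]

abbreviation incl :: "V \<Rightarrow> nat \<Rightarrow> nat \<Rightarrow> real" where
  "incl v \<equiv> (\<lambda>n. embV v)"

abbreviation xdiff :: "(nat \<Rightarrow> nat \<Rightarrow> real) \<Rightarrow> (nat \<Rightarrow> nat \<Rightarrow> real) \<Rightarrow> nat \<Rightarrow> nat \<Rightarrow> real" where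
  "xdiff s t \<equiv> xadd s (xscale (-1) t)"

lemma XmuD: "s \<in> Xmu \<mu> \<Longrightarrow> s n \<in> c00"
  by (simp add: Xmu_def)

lemma Xmu_Cauchy:
  "s \<in> Xmu \<mu> \<Longrightarrow> e > 0 \<Longrightarrow> \<exists>N. \<forall>m\<ge>N. \<forall>n\<ge>N. mu_bar \<mu> (\<lambda>i. s m i - s n i) < e"
  by (simp add: Xmu_def)

lemma Xmu_const: "x \<in> c00 \<Longrightarrow> (\<lambda>n. x) \<in> Xmu \<mu>"
  using mu_bar(3)[OF c00_0 c00_0] by (simp add: Xmu_def)

lemma Xmu_add:
  assumes s: "s \<in> Xmu \<mu>" and t: "t \<in> Xmu \<mu>"
  shows "xadd s t \<in> Xmu \<mu>"
  unfolding Xmu_def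
proof (intro CollectI conjI allI impI)
  show "xadd s t n \<in> c00" for n using XmuD[OF s] XmuD[OF t] by (simp add: xadd_def)
  fix e :: real assume "e > 0"
  then have "e / 2 > 0" by simp
  from Xmu_Cauchy[OF s this] Xmu_Cauchy[OF t this] obtain M N
    where M: "\<And>m n. m \<ge> M \<Longrightarrow> n \<ge> M \<Longrightarrow> mu_bar \<mu> (\<lambda>i. s m i - s n i) < e / 2"
      and N: "\<And>m n. m \<ge> N \<Longrightarrow> n \<ge> N \<Longrightarrow> mu_bar \<mu> (\<lambda>i. t m i - t n i) < e / 2" by blast
  have "mu_bar \<mu> (\<lambda>i. xadd s t m i - xadd s t n i) < e" if "m \<ge> max M N" "n \<ge> max M N" for m n
  proof -
    have "mu_bar \<mu> (\<lambda>i. (s m i - s n i) + (t m i - t n i))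
      \<le> mu_bar \<mu> (\<lambda>i. s m i - s n i) + mu_bar \<mu> (\<lambda>i. t m i - t n i)"
      using XmuD[OF s] XmuD[OF t] by (intro mu_bar(1)) auto
    then show ?thesis using M[of m n] N[of m n] that by (simp add: xadd_def algebra_simps)
  qed
  then show "\<exists>N. \<forall>m\<ge>N. \<forall>n\<ge>N. mu_bar \<mu> (\<lambda>i. xadd s t m i - xadd s t n i) < e" by blast
qed

lemma Xmu_scale:
  assumes s: "s \<in> Xmu \<mu>"
  shows "xscale c s \<in> Xmu \<mu>"
  unfolding Xmu_def
proof (intro CollectI conjI allI impI)
  show "xscale c s n \<in> c00" for n using XmuD[OF s] by (simp add: xscale_def)
  fix e :: real assume "e > 0"
  then have "e / (\<bar>c\<bar> + 1) > 0" by simp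
  from Xmu_Cauchy[OF s this] obtain N
    where N: "\<And>m n. m \<ge> N \<Longrightarrow> n \<ge> N \<Longrightarrow> mu_bar \<mu> (\<lambda>i. s m i - s n i) < e / (\<bar>c\<bar> + 1)" by blast
  have "mu_bar \<mu> (\<lambda>i. xscale c s m i - xscale c s n i) < e" if "m \<ge> N" "n \<ge> N" for m n
  proof -
    have *: "(\<lambda>i. s m i - s n i) \<in> c00" using XmuD[OF s] by simp
    have "mu_bar \<mu> (\<lambda>i. xscale c s m i - xscale c s n i) = \<bar>c\<bar> * mu_bar \<mu> (\<lambda>i. s m i - s n i)"
      using mu_bar(2)[OF * *, of c] by (simp add: xscale_def algebra_simps)
    also have "\<dots> \<le> (\<bar>c\<bar> + 1) * mu_bar \<mu> (\<lambda>i. s m i - s n i)"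
      using mu_bar(4)[OF * *] by (intro mult_right_mono) auto
    also have "\<dots> < e" using N[OF that] by (simp add: field_simps)
    finally show ?thesis .
  qed
  then show "\<exists>N. \<forall>m\<ge>N. \<forall>n\<ge>N. mu_bar \<mu> (\<lambda>i. xscale c s m i - xscale c s n i) < e" by blast
qed

lemma Xmu_lincomb: "(\<And>k. k < m \<Longrightarrow> s k \<in> Xmu \<mu>) \<Longrightarrow> xlincomb m a s \<in> Xmu \<mu>"
proof (induction m)
  case 0
  then show ?case using Xmu_const[OF c00_0] by (simp add: xlincomb_def)
next
  case (Suc m)
  have "xlincomb (Suc m) a s = xadd (xlincomb m a s) (xscale (a m) (s m))"
    by (simp add: xlincomb_def xadd_def xscale_def)
  then show ?case using Suc by (simp add: Xmu_add Xmu_scale)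
qed

text \<open>The \<open>lim\<close> in \<open>xnorm\<close> has meaning only once convergence is
  known; the reverse triangle inequality turns Cauchy sequences in \<open>c00\<close> into Cauchy
  sequences of seminorms.\<close>

lemma xnorm_tendsto:
  assumes s: "s \<in> Xmu \<mu>"
  shows "(\<lambda>n. mu_bar \<mu> (s n)) \<longlonglongrightarrow> xnorm \<mu> s"
proof -
  have "Cauchy (\<lambda>n. mu_bar \<mu> (s n))"
  proof (rule metric_CauchyI)
    fix e :: real assume "e > 0"
    then obtain N where N: "\<And>m n. m \<ge> N \<Longrightarrow> n \<ge> N \<Longrightarrow> mu_bar \<mu> (\<lambda>i. s m i - s n i) < e"
      using Xmu_Cauchy[OF s] by blast
    then show "\<exists>M. \<forall>m\<ge>M. \<forall>n\<ge>M. dist (mu_bar \<mu> (s m)) (mu_bar \<mu> (s n)) < e"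
      unfolding dist_real_def
      by (intro exI[of _ N]) (blast intro: le_less_trans[OF mu_bar(7)[OF XmuD[OF s] XmuD[OF s]]])
  qed
  then show ?thesis by (simp add: xnorm_def Cauchy_convergent_iff convergent_LIMSEQ_iff)
qed

lemma xnorm_const [simp]: "xnorm \<mu> (\<lambda>n. x) = mu_bar \<mu> x"
  by (simp add: xnorm_def)

lemma xnorm_add: "s \<in> Xmu \<mu> \<Longrightarrow> t \<in> Xmu \<mu> \<Longrightarrow> xnorm \<mu> (xadd s t) \<le> xnorm \<mu> s + xnorm \<mu> t"
  by (rule LIMSEQ_le[OF xnorm_tendsto[OF Xmu_add] tendsto_add[OF xnorm_tendsto xnorm_tendsto]])
    (auto simp: xadd_def XmuD intro!: mu_bar(1))

lemma xnorm_scale: "s \<in> Xmu \<mu> \<Longrightarrow> xnorm \<mu> (xscale c s) = \<bar>c\<bar> * xnorm \<mu> s"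
proof -
  assume s: "s \<in> Xmu \<mu>"
  have "(\<lambda>n. mu_bar \<mu> (xscale c s n)) \<longlonglongrightarrow> \<bar>c\<bar> * xnorm \<mu> s"
    unfolding xscale_def mu_bar(2)[OF XmuD[OF s] XmuD[OF s]]
    by (intro tendsto_mult_left xnorm_tendsto s)
  then show ?thesis using xnorm_tendsto[OF Xmu_scale[OF s]] LIMSEQ_unique by blast
qed

lemma xnorm_nonneg: "s \<in> Xmu \<mu> \<Longrightarrow> xnorm \<mu> s \<ge> 0"
  by (rule LIMSEQ_le_const[OF xnorm_tendsto]) (auto intro!: mu_bar(4) XmuD)

lemma xnorm_diff:
  assumes "s \<in> Xmu \<mu>" "t \<in> Xmu \<mu>"
  shows "\<bar>xnorm \<mu> s - xnorm \<mu> t\<bar> \<le> xnorm \<mu> (xdiff s t)"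
proof -
  have 1: "xdiff s t \<in> Xmu \<mu>" and "xdiff t s \<in> Xmu \<mu>" using assms by (auto intro: Xmu_add Xmu_scale)
  then have "xnorm \<mu> (xadd (xdiff s t) t) \<le> xnorm \<mu> (xdiff s t) + xnorm \<mu> t"
    "xnorm \<mu> (xadd (xdiff t s) s) \<le> xnorm \<mu> (xdiff t s) + xnorm \<mu> s"
    using assms by (auto intro: xnorm_add)
  moreover have "xadd (xdiff s t) t = s" "xadd (xdiff t s) s = t" "xdiff t s = xscale (-1) (xdiff s t)"
    by (simp_all add: xadd_def xscale_def)
  ultimately show ?thesis using xnorm_scale[OF 1, of "-1"] by simp
qed

text \<open>A late term of \<open>y\<close> is close to \<open>y\<close>, and a rational vector is
  close to that term. Thirds are used because the limit only preserves the non-strict bound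
  \<open>2 * e / 3\<close>.\<close>

lemma incl_dense:
  assumes y: "y \<in> Xmu \<mu>" and e: "e > 0"
  obtains v where "xnorm \<mu> (xdiff y (incl v)) < e"
proof -
  obtain N where N: "\<And>m n. m \<ge> N \<Longrightarrow> n \<ge> N \<Longrightarrow> mu_bar \<mu> (\<lambda>i. y m i - y n i) < e / 3"
    using Xmu_Cauchy[OF y, of "e / 3"] e by auto
  obtain v where v: "mu_bar \<mu> (\<lambda>i. y N i - embV v i) < e / 3"
    using embV_dense[OF mu_bar_seminorm_extension(1)[OF mu] XmuD[OF y], of "e / 3" N] e by auto
  have "mu_bar \<mu> (xdiff y (incl v) m) \<le> e / 3 + e / 3" if "m \<ge> N" for m
  proof -
    have "mu_bar \<mu> (\<lambda>i. (y m i - y N i) + (y N i - embV v i))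
      \<le> mu_bar \<mu> (\<lambda>i. y m i - y N i) + mu_bar \<mu> (\<lambda>i. y N i - embV v i)"
      using XmuD[OF y] by (intro mu_bar(1)) auto
    then show ?thesis using N[OF that order_refl] v by (simp add: xadd_def xscale_def)
  qed
  then have "xnorm \<mu> (xdiff y (incl v)) \<le> e / 3 + e / 3"
    by (intro LIMSEQ_le_const2[OF xnorm_tendsto[OF Xmu_add[OF y Xmu_scale[OF Xmu_const]]]]) auto
  then show thesis using e by (intro that[of v]) simp
qed

text \<open>Extend \<open>h\<close> linearly to \<open>c00\<close>, then by limits along Cauchy
  sequences; domination of \<open>ext h\<close> by \<open>mu_bar \<mu>\<close> makes these limits
  exist and bounds them.\<close>

lemma dual_ball_extension:
  assumes h: "h \<in> ratdual \<mu>"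
  obtains f where "f \<in> dual_ball \<mu>" "\<And>v. f (incl v) = h v"
proof -
  define f where "f s = lim (\<lambda>n. ext h (s n))" for s
  note le = mu_bar_seminorm_extension(3)[OF mu h]
  have lim: "(\<lambda>n. ext h (s n)) \<longlonglongrightarrow> f s" if s: "s \<in> Xmu \<mu>" for s
  proof -
    have "Cauchy (\<lambda>n. ext h (s n))"
    proof (rule metric_CauchyI)
      fix e :: real assume "e > 0"
      then obtain N where N: "\<And>m n. m \<ge> N \<Longrightarrow> n \<ge> N \<Longrightarrow> mu_bar \<mu> (\<lambda>i. s m i - s n i) < e"
        using Xmu_Cauchy[OF s] by blast
      have "ext h (s m) - ext h (s n) = ext h (\<lambda>i. s m i - s n i)" for m n
        using ext_add[of "\<lambda>i. s m i - s n i" "s n" h] XmuD[OF s] by simp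
      then have *: "\<bar>ext h (s m) - ext h (s n)\<bar> \<le> mu_bar \<mu> (\<lambda>i. s m i - s n i)" for m n
        using le[of "\<lambda>i. s m i - s n i"] XmuD[OF s] by simp
      then show "\<exists>M. \<forall>m\<ge>M. \<forall>n\<ge>M. dist (ext h (s m)) (ext h (s n)) < e"
        unfolding dist_real_def using N by (intro exI[of _ N]) (blast intro: le_less_trans[OF *])
    qed
    then show ?thesis by (simp add: f_def Cauchy_convergent_iff convergent_LIMSEQ_iff)
  qed
  have "f \<in> dual_ball \<mu>" unfolding dual_ball_def
  proof (intro CollectI conjI ballI allI)
    fix s t a b assume s: "s \<in> Xmu \<mu>" and t: "t \<in> Xmu \<mu>"
    have "(\<lambda>n. ext h (xadd (xscale a s) (xscale b t) n)) = (\<lambda>n. a * ext h (s n) + b * ext h (t n))"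
      using XmuD[OF s] XmuD[OF t] by (simp add: xadd_def xscale_def ext_add ext_scale)
    moreover have "(\<lambda>n. a * ext h (s n) + b * ext h (t n)) \<longlonglongrightarrow> a * f s + b * f t"
      by (intro tendsto_intros lim s t)
    ultimately show "f (xadd (xscale a s) (xscale b t)) = a * f s + b * f t"
      using lim[OF Xmu_add[OF Xmu_scale[OF s] Xmu_scale[OF t]]] LIMSEQ_unique by metis
  next
    fix s assume s: "s \<in> Xmu \<mu>"
    show "\<bar>f s\<bar> \<le> xnorm \<mu> s"
      by (rule LIMSEQ_le[OF tendsto_rabs[OF lim[OF s]] xnorm_tendsto[OF s]]) (auto intro!: le XmuD s)
  qed
  moreover have "f (incl v) = h v" for v
    using h by (simp add: f_def ext_embV ratdual_def)
  ultimately show thesis by (rule that)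
qed

text \<open>The converse passage: restriction to constant rational sequences. Functionals on the
  completion can thus be replaced by functionals on \<open>V\<close>.\<close>

lemma dual_ball_ratdual:
  assumes f: "f \<in> dual_ball \<mu>"
  shows "(\<lambda>v. f (incl v)) \<in> ratdual \<mu>"
proof -
  have "f (incl (u + v)) = f (incl u) + f (incl v)" for u v
  proof -
    have "incl (u + v) = xadd (xscale 1 (incl u)) (xscale 1 (incl v))"
      by (simp add: embV_add xadd_def xscale_def)
    then show ?thesis using f Xmu_const[OF c00_embV] by (simp add: dual_ball_def)
  qed
  moreover have "\<bar>f (incl v)\<bar> \<le> \<mu> v" for v
    using f Xmu_const[OF c00_embV] by (force simp: dual_ball_def mu_bar_embV)
  ultimately show ?thesis by (simp add: ratdual_def Modules.additive_def)
qed

lemma dual_ball_diff: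
  assumes f: "f \<in> dual_ball \<mu>" and "s \<in> Xmu \<mu>" "t \<in> Xmu \<mu>"
  shows "\<bar>f s - f t\<bar> \<le> xnorm \<mu> (xdiff s t)"
proof -
  have "f (xadd (xscale 1 s) (xscale (-1) t)) = 1 * f s + (-1) * f t"
    using assms unfolding dual_ball_def by blast
  moreover have "xscale 1 s = s" by (simp add: xscale_def)
  moreover have "\<bar>f (xdiff s t)\<bar> \<le> xnorm \<mu> (xdiff s t)"
    using assms Xmu_add Xmu_scale by (simp add: dual_ball_def)
  ultimately show ?thesis by simp
qed

end

section \<open>Total boundedness in finite-dimensional seminormed spaces\<close>

text \<open>A copy of m-dimensional space inside the real sequences, so that induction on the
  dimension stays within one type.\<close>

definition supp_below :: "nat \<Rightarrow> (nat \<Rightarrow> real) \<Rightarrow> bool" where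
  "supp_below m a \<longleftrightarrow> (\<forall>k\<ge>m. a k = 0)"

text \<open>The intended \<open>N a\<close> is the norm of the linear combination with coefficients
  \<open>a\<close>. It is only a seminorm, as the vectors combined may be linearly dependent in the
  completion.\<close>

locale coeff_seminorm =
  fixes N :: "(nat \<Rightarrow> real) \<Rightarrow> real"
  assumes N_add: "N (\<lambda>k. a k + b k) \<le> N a + N b"
    and N_scale: "N (\<lambda>k. c * a k) = \<bar>c\<bar> * N a"
begin

lemma N_minus: "N (\<lambda>k. a k - b k) = N (\<lambda>k. b k - a k)"
  using N_scale[of "-1" "\<lambda>k. a k - b k"] by simp

lemma N_triangle: "N (\<lambda>k. a k - c k) \<le> N (\<lambda>k. a k - b k) + N (\<lambda>k. b k - c k)"
  using N_add[of "\<lambda>k. a k - b k" "\<lambda>k. b k - c k"] by simp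

lemma N_diff: "N (\<lambda>k. a k - b k) \<le> N a + N b"
  using N_add[of a "\<lambda>k. - b k"] N_scale[of "-1" b] by simp

lemma N_zero: "N (\<lambda>k. 0) = 0"
  using N_scale[of 0 "\<lambda>k. 0"] by simp

lemma N_nonneg: "N a \<ge> 0"
  using N_diff[of a a] N_zero by simp

text \<open>Bolzano--Weierstrass by induction on the dimension. If the last unit vector
  \<open>e\<close> has distance zero from the span of the others, it can be eliminated; otherwise a
  positive distance bounds the last coordinates, and subsequences are extracted first for these and
  then for the remainders.\<close>

lemma N_bounded_imp_convergent_subsequence:
  assumes "\<And>n. supp_below m (a n)" "\<And>n. N (a n) \<le> R"
  shows "\<exists>r b. strict_mono (r :: nat \<Rightarrow> nat) \<and> supp_below m b \<and> (\<lambda>n. N (\<lambda>k. a (r n) k - b k)) \<longlonglongrightarrow> 0"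
  using assms
proof (induction m arbitrary: a R)
  case 0
  then have "a n = (\<lambda>k. 0)" for n by (auto simp: supp_below_def)
  then show ?case
    by (intro exI[of _ id] exI[of _ "\<lambda>k. 0"]) (auto simp: supp_below_def N_zero strict_mono_def)
next
  case (Suc m)
  define e where "e = (\<lambda>k. if k = m then 1 else 0 :: real)"
  show ?case
  proof (cases "\<exists>c. supp_below m c \<and> N (\<lambda>k. e k - c k) = 0")
    case True
    then obtain c where c: "supp_below m c" "N (\<lambda>k. e k - c k) = 0" by blast
    \<comment> \<open>Subtracting a multiple of the null vector \<open>e - c\<close> kills the last
      coordinate without changing any seminorm distance.\<close>
    define a' where "a' n = (\<lambda>k. a n k - a n m * (e k - c k))" for n
    have z: "N (\<lambda>k. t * (e k - c k)) = 0" for t using N_scale[of t] c(2) by simp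
    have "supp_below m (a' n)" for n
      using Suc.prems(1)[of n] c(1) by (auto simp: supp_below_def a'_def e_def le_Suc_eq Suc_le_eq)
    moreover have "N (a' n) \<le> R" for n
      using N_diff[of "a n" "\<lambda>k. a n m * (e k - c k)"] Suc.prems(2)[of n] z[of "a n m"]
      by (simp add: a'_def)
    ultimately obtain r b where rb: "strict_mono (r :: nat \<Rightarrow> nat)" "supp_below m b"
        "(\<lambda>n. N (\<lambda>k. a' (r n) k - b k)) \<longlonglongrightarrow> 0"
      using Suc.IH[of a' R] by blast
    have "N (\<lambda>k. a n k - b k) \<le> N (\<lambda>k. a' n k - b k)" for n
      using N_add[of "\<lambda>k. a' n k - b k" "\<lambda>k. a n m * (e k - c k)"] z[of "a n m"]
      by (simp add: a'_def)
    then have "(\<lambda>n. N (\<lambda>k. a (r n) k - b k)) \<longlonglongrightarrow> 0"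
      by (intro tendsto_sandwich[OF _ _ tendsto_const rb(3)]) (auto simp: N_nonneg)
    moreover have "supp_below (Suc m) b" using rb(2) by (simp add: supp_below_def)
    ultimately show ?thesis using rb(1) by blast
  next
    case False
    \<comment> \<open>Otherwise some \<open>c n\<close> in the span of the earlier unit vectors
      approach \<open>e\<close>. They are bounded, so by induction a subsequence has a limit
      \<open>b\<close> with \<open>N (\<lambda>k. e k - b k) = 0\<close>, against the case
      assumption.\<close>
    have "\<exists>d>0. \<forall>c. supp_below m c \<longrightarrow> d \<le> N (\<lambda>k. e k - c k)"
    proof (rule ccontr)
      assume "\<not> ?thesis"
      then have "\<exists>c. supp_below m c \<and> N (\<lambda>k. e k - c k) < 1 / Suc n" for n
        by (meson not_le of_nat_0_less_iff zero_less_Suc zero_less_divide_1_iff)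
      then obtain c where c: "\<And>n. supp_below m (c n)" "\<And>n. N (\<lambda>k. e k - c n k) < 1 / Suc n" by metis
      have bound: "N (c n) \<le> N e + 1" for n
      proof -
        have "N (c n) \<le> N e + N (\<lambda>k. e k - c n k)"
          using N_diff[of e "\<lambda>k. e k - c n k"] by simp
        moreover have "1 / Suc n \<le> (1::real)" by simp
        ultimately show ?thesis using c(2)[of n] by linarith
      qed
      obtain r b where rb: "strict_mono (r :: nat \<Rightarrow> nat)" "supp_below m b"
          "(\<lambda>n. N (\<lambda>k. c (r n) k - b k)) \<longlonglongrightarrow> 0"
        using Suc.IH[of c "N e + 1", OF c(1) bound] by (elim exE conjE)
      have "(\<lambda>n. 1 / Suc (r n)) \<longlonglongrightarrow> (0::real)"
        using LIMSEQ_subseq_LIMSEQ[OF LIMSEQ_inverse_real_of_nat rb(1)]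
        by (simp add: o_def inverse_eq_divide)
      from tendsto_add[OF this rb(3)] have "(\<lambda>n. 1 / Suc (r n) + N (\<lambda>k. c (r n) k - b k)) \<longlonglongrightarrow> 0"
        by simp
      moreover have "N (\<lambda>k. e k - b k) \<le> 1 / Suc (r n) + N (\<lambda>k. c (r n) k - b k)" for n
        using N_triangle[of e b "c (r n)"] c(2)[of "r n"] by linarith
      ultimately have "N (\<lambda>k. e k - b k) \<le> 0" by (intro LIMSEQ_le_const) auto
      then show False using False rb(2) N_nonneg[of "\<lambda>k. e k - b k"] by force
    qed
    then obtain d where d: "d > 0" "\<And>c. supp_below m c \<Longrightarrow> d \<le> N (\<lambda>k. e k - c k)" by blast
    define a' where "a' n = (\<lambda>k. a n k - a n m * e k)" for n
    have supp: "supp_below m (a' n)" for n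
      using Suc.prems(1)[of n] by (auto simp: supp_below_def a'_def e_def Suc_le_eq)
    have last: "\<bar>a n m\<bar> \<le> R / d" for n
    proof (cases "a n m = 0")
      case True
      then show ?thesis using d(1) N_nonneg[of "a n"] Suc.prems(2)[of n] by simp
    next
      case False
      \<comment> \<open>Factoring out the last coordinate: \<open>a n\<close> is
        \<open>a n m\<close> times \<open>e - c\<close>, so the distance \<open>d\<close> controls
        \<open>a n m\<close>.\<close>
      define c where "c = (\<lambda>k. - a' n k / a n m)"
      have "supp_below m c" using supp[of n] by (simp add: supp_below_def c_def)
      then have "\<bar>a n m\<bar> * d \<le> \<bar>a n m\<bar> * N (\<lambda>k. e k - c k)"
        by (intro mult_left_mono d(2)) auto
      also have "\<dots> = N (\<lambda>k. a n m * (e k - c k))" by (rule N_scale[symmetric])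
      also have "(\<lambda>k. a n m * (e k - c k)) = a n"
        using False by (simp add: c_def a'_def fun_eq_iff field_simps)
      also have "N (a n) \<le> R" by (rule Suc.prems)
      finally show ?thesis using d(1) by (simp add: field_simps)
    qed
    then have bdd: "bounded (range (\<lambda>n. a n m))" by (auto intro!: boundedI[of _ "R / d"])
    obtain t r1 where r1: "strict_mono (r1 :: nat \<Rightarrow> nat)" "((\<lambda>n. a n m) \<circ> r1) \<longlonglongrightarrow> t"
      using bounded_imp_convergent_subsequence[OF bdd] by blast
    have bound: "N (a' n) \<le> R + R / d * N e" for n
    proof -
      have "N (a' n) \<le> N (a n) + \<bar>a n m\<bar> * N e"
        using N_diff[of "a n" "\<lambda>k. a n m * e k"] by (simp add: a'_def N_scale)
      also have "\<dots> \<le> R + R / d * N e"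
        using last[of n] Suc.prems(2)[of n] N_nonneg[of e] by (intro add_mono mult_right_mono)
      finally show ?thesis .
    qed
    obtain r2 b where r2: "strict_mono (r2 :: nat \<Rightarrow> nat)" "supp_below m b"
        "(\<lambda>n. N (\<lambda>k. a' (r1 (r2 n)) k - b k)) \<longlonglongrightarrow> 0"
      using Suc.IH[of "\<lambda>n. a' (r1 n)", OF supp bound] by (elim exE conjE)
    define r where "r = r1 \<circ> r2"
    have "(\<lambda>n. a (r n) m) \<longlonglongrightarrow> t"
      using LIMSEQ_subseq_LIMSEQ[OF r1(2) r2(1)] by (simp add: r_def o_def)
    from tendsto_mult_right[OF tendsto_rabs[OF LIM_zero[OF this]], of "N e"]
    have lim: "(\<lambda>n. N (\<lambda>k. a' (r n) k - b k) + \<bar>a (r n) m - t\<bar> * N e) \<longlonglongrightarrow> 0"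
      using tendsto_add[OF r2(3)] by (fastforce simp: r_def)
    define b' where "b' = (\<lambda>k. b k + t * e k)"
    have le: "N (\<lambda>k. a n k - b' k) \<le> N (\<lambda>k. a' n k - b k) + \<bar>a n m - t\<bar> * N e" for n
      using N_add[of "\<lambda>k. a' n k - b k" "\<lambda>k. (a n m - t) * e k"] N_scale[of "a n m - t" e]
      by (simp add: a'_def b'_def algebra_simps)
    have "(\<lambda>n. N (\<lambda>k. a (r n) k - b' k)) \<longlonglongrightarrow> 0"
      by (rule tendsto_sandwich[OF _ _ tendsto_const lim]) (use N_nonneg le in simp_all)
    moreover have "supp_below (Suc m) b'"
      using r2(2) by (auto simp: supp_below_def b'_def e_def)
    moreover have "strict_mono r" using r1 r2 by (simp add: r_def strict_mono_o)
    ultimately show ?thesis by blast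
  qed
qed

text \<open>Without a finite net one chooses successively a bounded sequence with pairwise distances
  at least \<open>\<eta>\<close>, which contradicts the convergent subsequence.\<close>

lemma finite_net:
  assumes "\<eta> > 0"
  shows "\<exists>B. finite B \<and> (\<forall>a. supp_below m a \<longrightarrow> N a \<le> R \<longrightarrow> (\<exists>b\<in>B. N (\<lambda>k. a k - b k) < \<eta>))"
proof (rule ccontr)
  assume "\<not> ?thesis"
  then have no: "\<exists>a. supp_below m a \<and> N a \<le> R \<and> (\<forall>b\<in>B. \<eta> \<le> N (\<lambda>k. a k - b k))" if "finite B" for B
    using that by (meson not_le)
  define P where "P f n r \<longleftrightarrow> supp_below m r \<and> N r \<le> R \<and> (\<forall>i<n. \<eta> \<le> N (\<lambda>k. r k - f i k))"
    for f and n :: nat and r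
  have "\<exists>x. \<forall>n. P x n (x n)"
  proof (rule dependent_wellorder_choice)
    show "\<exists>r. P f n r" for n f
      using no[of "f ` {..<n}"] by (auto simp: P_def)
  qed (simp add: P_def)
  then obtain x :: "nat \<Rightarrow> nat \<Rightarrow> real" where x: "\<And>n. supp_below m (x n)" "\<And>n. N (x n) \<le> R"
      "\<And>i n. i < n \<Longrightarrow> \<eta> \<le> N (\<lambda>k. x n k - x i k)"
    unfolding P_def by blast
  obtain r b where rb: "strict_mono (r :: nat \<Rightarrow> nat)" "(\<lambda>n. N (\<lambda>k. x (r n) k - b k)) \<longlonglongrightarrow> 0"
    using N_bounded_imp_convergent_subsequence[of m x R, OF x(1,2)] by blast
  then have "\<forall>\<^sub>F n in sequentially. N (\<lambda>k. x (r n) k - b k) < \<eta> / 2"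
    using assms by (intro order_tendstoD) auto
  then obtain n where "\<And>j. j \<ge> n \<Longrightarrow> N (\<lambda>k. x (r j) k - b k) < \<eta> / 2"
    unfolding eventually_sequentially by blast
  then have n: "N (\<lambda>k. x (r n) k - b k) < \<eta> / 2" "N (\<lambda>k. x (r (Suc n)) k - b k) < \<eta> / 2"
    by simp_all
  have "\<eta> \<le> N (\<lambda>k. x (r (Suc n)) k - x (r n) k)"
    using rb(1) by (intro x(3)) (simp add: strict_mono_def)
  also have "\<dots> \<le> N (\<lambda>k. x (r (Suc n)) k - b k) + N (\<lambda>k. b k - x (r n) k)" by (rule N_triangle)
  also have "\<dots> < \<eta>" using n by (simp add: N_minus[of b])
  finally show False by simp
qed

end

section \<open>A countable test for weak octahedrality\<close>

text \<open>The certificate that no functional dominated by \<open>\<mu>\<close> comes strictly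
  within \<open>\<delta>\<close> of the data. The inequality is non-strict to make the condition
  closed in \<open>\<mu>\<close>; a nonzero coefficient on \<open>G\<close> is demanded because zero
  coefficients give equality.\<close>

definition infeasible :: "(V \<Rightarrow> real) \<Rightarrow> (V \<times> rat) set \<Rightarrow> real \<Rightarrow> (V \<times> rat \<Rightarrow> rat) \<Rightarrow> bool" where
  "infeasible \<mu> G \<delta> l \<longleftrightarrow> (\<exists>g\<in>G. l g \<noteq> 0) \<and>
    \<mu> (\<Sum>g\<in>G. vscaleQ (l g) (fst g)) + \<delta> * (\<Sum>g\<in>G. \<bar>of_rat (l g)\<bar>)
      \<le> (\<Sum>g\<in>G. of_rat (l g) * of_rat (snd g))"

text \<open>The loss \<open>3 * \<delta>\<close> covers three errors of size
  \<open>\<delta>\<close>: the octahedral slack, the approximation of the functional by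
  \<open>snd g\<close>, and that of the unit vector by \<open>w\<close>.\<close>

definition octahedral_at :: "(V \<Rightarrow> real) \<Rightarrow> (V \<times> rat) set \<Rightarrow> real \<Rightarrow> V \<Rightarrow> bool" where
  "octahedral_at \<mu> G \<delta> w \<longleftrightarrow>
    \<bar>\<mu> w - 1\<bar> \<le> \<delta> \<and> (\<forall>g\<in>G. \<bar>of_rat (snd g)\<bar> + 1 - 3 * \<delta> \<le> \<mu> (fst g + w))"

text \<open>Extensional functions keep the coefficient vectors countable for finite
  \<open>G\<close>.\<close>

definition woh_test :: "(V \<Rightarrow> real) \<Rightarrow> (V \<times> rat) set \<Rightarrow> real \<Rightarrow> bool" where
  "woh_test \<mu> G \<delta> \<longleftrightarrow> (\<exists>l\<in>G \<rightarrow>\<^sub>E UNIV. infeasible \<mu> G \<delta> l) \<or> (\<exists>w. octahedral_at \<mu> G \<delta> w)"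

context coded_space
begin

text \<open>Half of \<open>\<eta>\<close> goes into a net for the coefficient seminorm, the other
  half into moving its centres to \<open>V\<close>.\<close>

lemma span_finite_net:
  assumes s: "\<And>k. k < m \<Longrightarrow> s k \<in> Xmu \<mu>" and \<eta>: "\<eta> > 0"
  obtains A where "finite A"
    "\<And>a. xnorm \<mu> (xlincomb m a s) \<le> R \<Longrightarrow> \<exists>v\<in>A. xnorm \<mu> (xdiff (xlincomb m a s) (incl v)) < \<eta>"
proof -
  have lin: "xlincomb m a s \<in> Xmu \<mu>" for a using s by (rule Xmu_lincomb)
  have half: "\<eta> / 2 > 0" using \<eta> by simp
  have add: "xlincomb m (\<lambda>k. a k + b k) s = xadd (xlincomb m a s) (xlincomb m b s)"
    and scale: "xlincomb m (\<lambda>k. c * a k) s = xscale c (xlincomb m a s)"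
    for a b c
    by (simp_all add: xlincomb_def xadd_def xscale_def algebra_simps sum.distrib sum_distrib_left)
  define N where "N a = xnorm \<mu> (xlincomb m a s)" for a
  interpret coeff_seminorm N
    by unfold_locales (auto simp: N_def add scale intro!: xnorm_add xnorm_scale lin)
  obtain B where B: "finite B"
    "\<And>a. supp_below m a \<Longrightarrow> N a \<le> R \<Longrightarrow> \<exists>b\<in>B. N (\<lambda>k. a k - b k) < \<eta> / 2"
    using finite_net[OF half, of m R] by blast
  have "\<exists>v. xnorm \<mu> (xdiff (xlincomb m b s) (incl v)) < \<eta> / 2" for b
    using incl_dense[OF lin[of b] half] by blast
  then obtain v where v: "\<And>b. xnorm \<mu> (xdiff (xlincomb m b s) (incl (v b))) < \<eta> / 2" by metis
  have "\<exists>v\<in>v ` B. xnorm \<mu> (xdiff (xlincomb m a s) (incl v)) < \<eta>" if a: "xnorm \<mu> (xlincomb m a s) \<le> R" for a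
  proof -
    \<comment> \<open>Coefficients from \<open>m\<close> on do not affect the combination; cutting
      them off puts \<open>a'\<close> into the space covered by the net.\<close>
    define a' where "a' = (\<lambda>k. if k < m then a k else 0)"
    have eq: "xlincomb m a' s = xlincomb m a s" by (simp add: xlincomb_def a'_def)
    then obtain b where b: "b \<in> B" "N (\<lambda>k. a' k - b k) < \<eta> / 2"
      using B(2)[of a'] a by (auto simp: supp_below_def a'_def N_def)
    have "xdiff (xlincomb m a s) (incl (v b))
      = xadd (xlincomb m (\<lambda>k. a' k - b k) s) (xdiff (xlincomb m b s) (incl (v b)))"
      unfolding eq[symmetric]
      by (simp add: xlincomb_def xadd_def xscale_def algebra_simps sum_subtractf)
    then have "xnorm \<mu> (xdiff (xlincomb m a s) (incl (v b))) \<le>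
        N (\<lambda>k. a' k - b k) + xnorm \<mu> (xdiff (xlincomb m b s) (incl (v b)))"
      unfolding N_def using xnorm_add[OF lin Xmu_add[OF lin Xmu_scale[OF Xmu_const[OF c00_embV]]]] by simp
    then show ?thesis using b v[of b] by force
  qed
  then show thesis using B(1) by (intro that[of "v ` B"]) auto
qed

text \<open>If no certificate exists, interpolation produces a functional matching the data within
  \<open>\<delta>\<close>. Weak octahedrality for its extension and the span of the first components
  gives \<open>y\<close>, and a rational approximation of \<open>y\<close> is the required
  \<open>w\<close>.\<close>

lemma WOH_imp_woh_test:
  assumes "WOH \<mu>" and G: "finite G" and \<delta>: "\<delta> > 0"
  shows "woh_test \<mu> G \<delta>"
proof (rule ccontr)
  assume "\<not> ?thesis"
  then have no: "\<And>l. l \<in> G \<rightarrow>\<^sub>E UNIV \<Longrightarrow> \<not> infeasible \<mu> G \<delta> l" and no_w: "\<And>w. \<not> octahedral_at \<mu> G \<delta> w"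
    unfolding woh_test_def by blast+
  have "(\<Sum>g\<in>G. of_rat (l g) * of_rat (snd g))
      \<le> \<mu> (\<Sum>g\<in>G. vscaleQ (l g) (fst g)) + \<delta> * (\<Sum>g\<in>G. \<bar>of_rat (l g)\<bar>)" for l
  proof (cases "\<exists>g\<in>G. l g \<noteq> 0")
    case True
    \<comment> \<open>Restricting \<open>l\<close> to \<open>G\<close> makes it extensional and
      changes none of the sums.\<close>
    then show ?thesis using no[of "restrict l G"] by (simp add: infeasible_def)
  next
    case False
    then show ?thesis by (simp add: PsetD(3)[OF mu])
  qed
  then obtain h where h: "h \<in> ratdual \<mu>" "\<And>g. g \<in> G \<Longrightarrow> \<bar>h (fst g) - of_rat (snd g)\<bar> \<le> \<delta>"
    using ratdual_interpolation[OF mu G, of \<delta> "\<lambda>g. of_rat (snd g)" fst] \<delta> by auto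
  obtain f where f: "f \<in> dual_ball \<mu>" "\<And>v. f (incl v) = h v" using dual_ball_extension[OF h(1)] by blast
  obtain gs where gs: "set gs = G" using finite_list[OF G] by blast
  define s where "s k = incl (fst (gs ! k))" for k
  have s: "s k \<in> Xmu \<mu>" for k by (simp add: s_def Xmu_const)
  \<comment> \<open>\<open>M\<close> dominates \<open>\<bar>h (fst g)\<bar> + 1\<close> on
    \<open>G\<close>, so the multiplicative slack \<open>\<delta> / M\<close> costs at most
    \<open>\<delta>\<close>.\<close>
  define M where "M = (\<Sum>g\<in>G. \<mu> (fst g)) + 1"
  have M: "M > 0" unfolding M_def by (intro add_nonneg_pos sum_nonneg) (auto simp: PsetD(5)[OF mu])
  obtain y where y: "y \<in> Xmu \<mu>" "xnorm \<mu> y = 1"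
    and oct: "\<And>a. (1 - \<delta> / M) * (\<bar>f (xlincomb (length gs) a s)\<bar> + 1)
      \<le> xnorm \<mu> (xadd (xlincomb (length gs) a s) y)"
    using assms(1)[unfolded WOH_def, rule_format, of "length gs" s f "\<delta> / M"] s f(1) \<delta> M
    by (auto simp: Let_def)
  have oct': "\<bar>h (fst g)\<bar> + 1 - \<delta> \<le> xnorm \<mu> (xadd (incl (fst g)) y)" if "g \<in> G" for g
  proof -
    obtain j where j: "j < length gs" "gs ! j = g" using \<open>g \<in> G\<close> gs by (metis in_set_conv_nth)
    have "xlincomb (length gs) (\<lambda>k. if k = j then 1 else 0) s = incl (fst g)"
      using j by (simp add: xlincomb_def s_def if_distrib[of "\<lambda>x. x * _"] cong: if_cong)
    then have "(1 - \<delta> / M) * (\<bar>h (fst g)\<bar> + 1) \<le> xnorm \<mu> (xadd (incl (fst g)) y)"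
      using oct f(2) by metis
    moreover have "\<bar>h (fst g)\<bar> + 1 \<le> M"
    proof -
      have "\<bar>h (fst g)\<bar> \<le> \<mu> (fst g)" using h(1) by (simp add: ratdual_def)
      also have "\<dots> \<le> (\<Sum>g\<in>G. \<mu> (fst g))" using G that by (intro member_le_sum) (auto simp: PsetD(5)[OF mu])
      finally show ?thesis by (simp add: M_def)
    qed
    then have "\<delta> / M * (\<bar>h (fst g)\<bar> + 1) \<le> \<delta> / M * M" using \<delta> M by (intro mult_left_mono) auto
    ultimately show ?thesis using M by (simp add: algebra_simps)
  qed
  obtain w where w: "xnorm \<mu> (xdiff y (incl w)) < \<delta>" using incl_dense[OF y(1) \<delta>] by blast
  have "\<bar>\<mu> w - 1\<bar> \<le> \<delta>"
    using xnorm_diff[OF y(1) Xmu_const[OF c00_embV[of w]]] w y(2) by (simp add: mu_bar_embV)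
  then obtain g where g: "g \<in> G" "\<mu> (fst g + w) < \<bar>of_rat (snd g)\<bar> + 1 - 3 * \<delta>"
    using no_w[of w] by (auto simp: octahedral_at_def not_le)
  have eq: "xdiff (xadd (incl (fst g)) y) (incl (fst g + w)) = xdiff y (incl w)"
    by (simp add: xadd_def xscale_def embV_add)
  have "\<bar>xnorm \<mu> (xadd (incl (fst g)) y) - \<mu> (fst g + w)\<bar> < \<delta>"
    using xnorm_diff[OF Xmu_add[OF Xmu_const[OF c00_embV] y(1)] Xmu_const[OF c00_embV], of "fst g" "fst g + w"] w
    by (simp add: mu_bar_embV eq)
  then show False using oct'[OF g(1)] h(2)[OF g(1)] g(2) by linarith
qed

text \<open>Vectors of norm above \<open>2 / \<epsilon>\<close> are handled by the triangle
  inequality. The remaining ball of the span has a finite net in \<open>V\<close>; pairing its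
  points with rational approximations of \<open>f\<close> gives data that \<open>f\<close> itself
  shows to be feasible, so the test returns \<open>w\<close>, and \<open>y\<close> is
  \<open>w\<close> normalised.\<close>

lemma woh_test_imp_WOH:
  assumes test: "\<And>G n. finite G \<Longrightarrow> woh_test \<mu> G (1 / Suc n)"
  shows "WOH \<mu>"
  unfolding WOH_def
proof (intro allI impI ballI)
  fix m :: nat and s f and \<epsilon> :: real
  assume s: "\<forall>k<m. s k \<in> Xmu \<mu>" and f: "f \<in> dual_ball \<mu>" and \<epsilon>: "\<epsilon> > 0"
  have lin: "xlincomb m a s \<in> Xmu \<mu>" for a using s by (intro Xmu_lincomb) auto
  obtain n where n: "inverse (real (Suc n)) < min (\<epsilon> / 8) (1 / 2)"
    using reals_Archimedean[of "min (\<epsilon> / 8) (1 / 2)"] \<epsilon> by auto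
  define \<delta> where "\<delta> = 1 / real (Suc n)"
  \<comment> \<open>The near case adds errors \<open>\<delta>\<close> for \<open>x\<close> against
    the net, \<open>\<delta>\<close> for the rational values, \<open>3 * \<delta>\<close> from the
    test and \<open>2 * \<delta>\<close> for \<open>x + y\<close>, which fits into
    \<open>8 * \<delta>\<close>. The bound \<open>1 / 2\<close> keeps \<open>\<mu> w\<close>
    positive.\<close>
  have \<delta>: "\<delta> > 0" "8 * \<delta> \<le> \<epsilon>" "\<delta> < 1 / 2" using n by (auto simp: \<delta>_def inverse_eq_divide)
  obtain A where A: "finite A"
    "\<And>a. xnorm \<mu> (xlincomb m a s) \<le> 2 / \<epsilon> \<Longrightarrow> \<exists>v\<in>A. xnorm \<mu> (xdiff (xlincomb m a s) (incl v)) < \<delta>"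
    using span_finite_net[of m s \<delta> "2 / \<epsilon>"] s \<delta>(1) by blast
  define h where "h v = f (incl v)" for v
  have h: "h \<in> ratdual \<mu>" using dual_ball_ratdual[OF f] by (simp add: h_def[abs_def])
  have hadd: "Modules.additive h" using h by (simp add: ratdual_def)
  have "\<exists>r. \<bar>h v - of_rat r\<bar> < \<delta>" for v
  proof -
    obtain r where "h v - \<delta> < of_rat r" "of_rat r < h v + \<delta>"
      using of_rat_dense[of "h v - \<delta>" "h v + \<delta>"] \<delta>(1) by auto
    then show ?thesis by (intro exI[of _ r]) auto
  qed
  then obtain q where q: "\<And>v. \<bar>h v - of_rat (q v)\<bar> < \<delta>" by metis
  define G where "G = (\<lambda>v. (v, q v)) ` A"
  have G: "finite G" using A(1) by (simp add: G_def)
  have Gq: "\<bar>h (fst g) - of_rat (snd g)\<bar> < \<delta>" if "g \<in> G" for g using that q by (auto simp: G_def)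
  have "\<mu> (\<Sum>g\<in>G. vscaleQ (l g) (fst g)) + \<delta> * (\<Sum>g\<in>G. \<bar>of_rat (l g)\<bar>)
        > (\<Sum>g\<in>G. of_rat (l g) * of_rat (snd g))" if nz: "\<exists>g\<in>G. l g \<noteq> 0" for l
  proof -
    obtain g0 where g0: "g0 \<in> G" "l g0 \<noteq> 0" using nz by blast
    \<comment> \<open>Termwise comparison. Strictness at a nonzero coefficient comes from the strict
      approximation in \<open>Gq\<close> and is what refutes the non-strict inequality in
      \<open>infeasible\<close>.\<close>
    define L R where "L g = of_rat (l g) * of_rat (snd g) - of_rat (l g) * h (fst g)"
      and "R g = \<delta> * \<bar>of_rat (l g)\<bar>" for g
    have le: "L g \<le> R g" and less: "l g \<noteq> 0 \<Longrightarrow> L g < R g" if "g \<in> G" for g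
    proof -
      have "L g = of_rat (l g) * (of_rat (snd g) - h (fst g))" by (simp add: L_def algebra_simps)
      also have "\<dots> \<le> \<bar>of_rat (l g)\<bar> * \<bar>h (fst g) - of_rat (snd g)\<bar>"
        by (metis abs_ge_self abs_minus_commute abs_mult)
      finally have *: "L g \<le> \<bar>of_rat (l g)\<bar> * \<bar>h (fst g) - of_rat (snd g)\<bar>" .
      show "l g \<noteq> 0 \<Longrightarrow> L g < R g"
        using Gq[OF that] by (intro le_less_trans[OF *]) (simp add: R_def mult.commute)
      then show "L g \<le> R g" by (cases "l g = 0") (auto simp: L_def R_def)
    qed
    have "(\<Sum>g\<in>G. L g) < (\<Sum>g\<in>G. R g)"
      using le less g0 by (intro sum_strict_mono_ex1 G) blast+
    moreover have "(\<Sum>g\<in>G. of_rat (l g) * h (fst g)) \<le> \<mu> (\<Sum>g\<in>G. vscaleQ (l g) (fst g))"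
    proof -
      have "(\<Sum>g\<in>G. of_rat (l g) * h (fst g)) = h (\<Sum>g\<in>G. vscaleQ (l g) (fst g))"
        by (simp add: additive.sum[OF hadd] additive_vscaleQ[OF hadd])
      also have "\<dots> \<le> \<mu> (\<Sum>g\<in>G. vscaleQ (l g) (fst g))"
        using h by (simp add: ratdual_def abs_le_iff)
      finally show ?thesis .
    qed
    ultimately show ?thesis by (simp add: L_def R_def sum_subtractf sum_distrib_left)
  qed
  then have "\<not> infeasible \<mu> G \<delta> l" for l unfolding infeasible_def not_le[symmetric] by blast
  then obtain w where "octahedral_at \<mu> G \<delta> w"
    using test[OF G, of n] unfolding woh_test_def \<delta>_def[symmetric] by blast
  then have w: "\<bar>\<mu> w - 1\<bar> \<le> \<delta>" "\<And>g. g \<in> G \<Longrightarrow> \<bar>of_rat (snd g)\<bar> + 1 - 3 * \<delta> \<le> \<mu> (fst g + w)"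
    by (simp_all add: octahedral_at_def)
  have pos: "\<mu> w > 0" using w(1) \<delta>(3) by linarith
  have incl: "incl v \<in> Xmu \<mu>" for v by (simp add: Xmu_const)
  define y where "y = xscale (1 / \<mu> w) (incl w)"
  have y: "y \<in> Xmu \<mu>" using incl by (simp add: y_def Xmu_scale)
  have ny: "xnorm \<mu> y = 1" using pos by (simp add: y_def xnorm_scale[OF incl] mu_bar_embV)
  have "xdiff y (incl w) = xscale (1 / \<mu> w - 1) (incl w)"
    by (simp add: y_def xadd_def xscale_def algebra_simps)
  then have "xnorm \<mu> (xdiff y (incl w)) = \<bar>1 / \<mu> w - 1\<bar> * \<bar>\<mu> w\<bar>"
    using pos by (simp add: xnorm_scale[OF incl] mu_bar_embV)
  also have "\<dots> = \<bar>1 - \<mu> w\<bar>" unfolding abs_mult[symmetric] using pos by (simp add: algebra_simps)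
  finally have yw: "xnorm \<mu> (xdiff y (incl w)) \<le> \<delta>" using w(1) by linarith
  have "(1 - \<epsilon>) * (\<bar>f x\<bar> + 1) \<le> xnorm \<mu> (xadd x y)" if x: "x = xlincomb m a s" for x a
  proof -
    have xX: "x \<in> Xmu \<mu>" using lin x by simp
    have fx: "\<bar>f x\<bar> \<le> xnorm \<mu> x" using f xX by (simp add: dual_ball_def)
    show ?thesis
    proof (cases "xnorm \<mu> x \<le> 2 / \<epsilon>")
      case True
      then obtain v where v: "v \<in> A" "xnorm \<mu> (xdiff x (incl v)) < \<delta>" using A(2)[of a] x by auto
      have "\<bar>f x - h v\<bar> < \<delta>" using dual_ball_diff[OF f xX incl, of v] v(2) by (simp add: h_def)
      moreover have "\<bar>of_rat (q v)\<bar> + 1 - 3 * \<delta> \<le> \<mu> (v + w)"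
        using w(2)[of "(v, q v)"] v(1) by (simp add: G_def)
      moreover have "\<bar>xnorm \<mu> (xadd x y) - \<mu> (v + w)\<bar> \<le> 2 * \<delta>"
      proof -
        have "xdiff (xadd x y) (incl (v + w)) = xadd (xdiff x (incl v)) (xdiff y (incl w))"
          by (simp add: xadd_def xscale_def embV_add algebra_simps)
        moreover have "xnorm \<mu> (xadd (xdiff x (incl v)) (xdiff y (incl w))) \<le> 2 * \<delta>"
          using xnorm_add[OF Xmu_add[OF xX Xmu_scale[OF incl]] Xmu_add[OF y Xmu_scale[OF incl]], of "-1" v "-1" w]
            v(2) yw by linarith
        ultimately show ?thesis
          using xnorm_diff[OF Xmu_add[OF xX y] incl, of "v + w"] by (simp add: mu_bar_embV)
      qed
      ultimately have "\<bar>f x\<bar> + 1 - 8 * \<delta> \<le> xnorm \<mu> (xadd x y)" using q[of v] \<delta>(1) by linarith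
      moreover have "0 \<le> \<epsilon> * \<bar>f x\<bar>" using \<epsilon> by simp
      ultimately show ?thesis using \<delta>(2) by (simp add: algebra_simps)
    next
      case False
      \<comment> \<open>Here \<open>\<epsilon> * xnorm \<mu> x \<ge> 2\<close> pays for the gap
        between \<open>xnorm \<mu> x + 1\<close> and \<open>xnorm \<mu> x - 1\<close>; for
        \<open>\<epsilon> > 1\<close> the left side of the goal is nonpositive anyway.\<close>
      have ge: "xnorm \<mu> x - 1 \<le> xnorm \<mu> (xadd x y)"
      proof -
        have "xdiff x (xscale (-1) y) = xadd x y" by (simp add: xadd_def xscale_def)
        then show ?thesis
          using xnorm_diff[OF xX Xmu_scale[OF y], of "-1"] xnorm_scale[OF y, of "-1"] ny by simp
      qed
      show ?thesis
      proof (cases "\<epsilon> \<le> 1")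
        case True
        then have "(1 - \<epsilon>) * (\<bar>f x\<bar> + 1) \<le> (1 - \<epsilon>) * (xnorm \<mu> x + 1)"
          using fx by (intro mult_left_mono) auto
        moreover have "2 \<le> \<epsilon> * xnorm \<mu> x" using False \<epsilon> by (simp add: field_simps)
        ultimately show ?thesis using ge \<epsilon> by (simp add: algebra_simps)
      next
        case False
        then have "(1 - \<epsilon>) * (\<bar>f x\<bar> + 1) \<le> 0" by (intro mult_nonpos_nonneg) auto
        then show ?thesis using xnorm_nonneg[OF Xmu_add[OF xX y]] by linarith
      qed
    qed
  qed
  then show "\<exists>y\<in>Xmu \<mu>. xnorm \<mu> y = 1 \<and> (\<forall>a. let x = xlincomb m a s in
              xnorm \<mu> (xadd x y) \<ge> (1 - \<epsilon>) * (\<bar>f x\<bar> + xnorm \<mu> y))"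
    using y ny by (auto simp: Let_def)
qed

end

theorem WOH_iff_woh_test:
  assumes "\<mu> \<in> Pset"
  shows "WOH \<mu> \<longleftrightarrow> (\<forall>G n. finite G \<longrightarrow> woh_test \<mu> G (1 / Suc n))"
proof -
  interpret coded_space \<mu> by unfold_locales fact
  show ?thesis using WOH_imp_woh_test woh_test_imp_WOH by auto
qed

section \<open>Countability of the parameters and the Borel class\<close>

lemma countable_UNIV_V: "countable (UNIV :: V set)"
proof -
  \<comment> \<open>A finite set of index-coefficient pairs is read as a sum of monomials; the graph
    of \<open>v\<close> over its support is sent to \<open>v\<close>.\<close>
  define J where "J = (\<lambda>F. \<Sum>(i, q)\<in>F. Poly_Mapping.single i (q :: rat) :: V)"
  have "v \<in> J ` {F :: (nat \<times> rat) set. finite F}" for v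
  proof (rule image_eqI[of _ _ "(\<lambda>i. (i, Poly_Mapping.lookup v i)) ` Poly_Mapping.keys v"])
    have "vscaleQ q (unitV i) = Poly_Mapping.single i q" for q i
      by (rule poly_mapping_eqI) (simp add: unitV_def lookup_single when_def)
    then have "v = (\<Sum>i\<in>Poly_Mapping.keys v. Poly_Mapping.single i (Poly_Mapping.lookup v i))"
      using sum_unitV[of v] by simp
    then show "v = J ((\<lambda>i. (i, Poly_Mapping.lookup v i)) ` Poly_Mapping.keys v)"
      by (simp add: J_def sum.reindex inj_on_def)
  qed simp
  then have "UNIV \<subseteq> J ` {F :: (nat \<times> rat) set. finite F}" by blast
  moreover have "countable {F :: (nat \<times> rat) set. finite F}" by (rule countable_Collect_finite)
  ultimately show ?thesis by (meson countable_image countable_subset)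
qed

lemma continuous_on_eval [continuous_intros]: "continuous_on A (\<lambda>\<mu> :: V \<Rightarrow> real. \<mu> v)"
  by (rule continuous_on_subset[OF continuous_on_product_coordinates]) simp

text \<open>For fixed \<open>l\<close> or \<open>w\<close> the conditions on \<open>\<mu>\<close>
  are non-strict inequalities between continuous functions, built from evaluations at points of
  \<open>V\<close>. Finiteness of \<open>G\<close> and countability of \<open>V\<close> make the
  union countable.\<close>

lemma fsigma_in_woh_test:
  assumes G: "finite G"
  shows "fsigma_in (subtopology euclidean I) {\<mu>\<in>I. woh_test \<mu> G \<delta>}"
proof -
  define C1 where "C1 l = {\<mu>\<in>I. infeasible \<mu> G \<delta> l}" for l
  define C2 where "C2 w = {\<mu>\<in>I. octahedral_at \<mu> G \<delta> w}" for w
  have sub: "closedin (subtopology euclidean I) {\<mu>\<in>I. P \<mu>}" if "closed {\<mu>. P \<mu>}" for P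
    using that closedin_closed_Int[of "{\<mu>. P \<mu>}" I] by (simp add: Int_def)
  have "closedin (subtopology euclidean I) (C1 l)" for l
    unfolding C1_def infeasible_def
    by (intro sub closed_Collect_conj closed_Collect_const closed_Collect_le continuous_intros)
  moreover have "closedin (subtopology euclidean I) (C2 w)" for w
    unfolding C2_def octahedral_at_def Ball_def
    by (intro sub closed_Collect_conj closed_Collect_all closed_Collect_imp open_Collect_const
        closed_Collect_le continuous_intros)
  moreover have "countable (G \<rightarrow>\<^sub>E (UNIV :: rat set))" using G by (intro countable_PiE) auto
  then have "countable (C1 ` (G \<rightarrow>\<^sub>E UNIV) \<union> range C2)" using countable_UNIV_V by blast
  moreover have "{\<mu>\<in>I. woh_test \<mu> G \<delta>} = \<Union>(C1 ` (G \<rightarrow>\<^sub>E UNIV) \<union> range C2)"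
    by (auto simp: woh_test_def C1_def C2_def)
  ultimately show ?thesis
    unfolding fsigma_in_def union_of_def by (intro exI[of _ "C1 ` (G \<rightarrow>\<^sub>E UNIV) \<union> range C2"]) auto
qed

theorem theorem6p6:
  assumes "I = Pinf \<or> I = Bset"
  shows "fsigmadelta_in (subtopology euclidean I) {\<mu>\<in>I. WOH \<mu>}"
proof -
  have I: "I \<subseteq> Pset" using assms by (auto simp: Pinf_def Bset_def)
  define \<G> where "\<G> = {G :: (V \<times> rat) set. finite G} \<times> (UNIV :: nat set)"
  define S where "S = (\<lambda>(G, n). {\<mu>\<in>I. woh_test \<mu> G (1 / real (Suc n))})"
  have "countable {G :: (V \<times> rat) set. finite G \<and> G \<subseteq> UNIV \<times> UNIV}"
    using countable_UNIV_V by (intro countable_Collect_finite_subset countable_SIGMA) auto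
  then have "countable (S ` \<G>)" by (simp add: \<G>_def)
  moreover have "fsigma_in (subtopology euclidean I) T" if "T \<in> S ` \<G>" for T
    using that by (auto simp: S_def \<G>_def fsigma_in_woh_test)
  ultimately have "(countable intersection_of fsigma_in (subtopology euclidean I)) (\<Inter>(S ` \<G>))"
    by (auto simp: intersection_of_def)
  \<comment> \<open>The intersection with \<open>I\<close> is the one that
    \<open>relative_to\<close> takes with \<open>topspace\<close>; the equality is the countable
    test, available because \<open>I\<close> consists of seminorms.\<close>
  moreover have "I \<inter> \<Inter>(S ` \<G>) = {\<mu>\<in>I. WOH \<mu>}"
    using I WOH_iff_woh_test by (auto simp: S_def \<G>_def subset_iff)
  ultimately show ?thesis
    unfolding fsigmadelta_in_def relative_to_def by auto
qed

end
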